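(* Let $M\in\mathbb{N}$ and write $M=t^2n$ with $t,n\in\mathbb{N}$ and $n$ squarefree. Then $N^{\mathrm{new}}_{\Gamma_0(M)}$ is of cocompact type, i.e. $c_2^{\mathrm{new}}(M)=c_3^{\mathrm{new}}(M)=0$, if and only if one of the following holds: (1) $n$ has at least two distinct prime factors; (2) $n>1$, $4\mid M$ and $(2,M/4)=1$.
   Context: Let $k_M$ be the number of inequivalent cusps of the Hecke congruence group $\Gamma_0(M)=\{\begin{pmatrix}a&b\\c&d\end{pmatrix}\in SL_2(\mathbb{Z}): c\equiv 0\bmod M\}$. Let $D(q)$ be the number of primitive Dirichlet characters mod $q$ and $\log A(M)=\sum_{m\mid M}\sum_{q\mid (m,M/m)}D(q)\log\frac{qM}{(m,M/m)}$ (natural logarithm; i.e. $A(M)$ is the product of $qM/(m,M/m)$ over all pairs $(m,\chi)$ with $\chi$ primitive mod $q$, $q\mid m$, $mq\mid M$). Define $c_2(M)=-\frac{2k_M}{\pi}$ and $c_3(M)=\frac1\pi\big[(2-\log2+\log\pi)k_M-\log A(M)\big]$ (these are the coefficients of $\sqrt\lambda\log\sqrt\lambda$ and $\sqrt\lambda$ in the asymptotic expansion of the eigenvalue counting function of the Laplacian on $\Gamma_0(M)\backslash\mathbb{H}$), and $c_i^{\mathrm{new}}=c_i*\sigma_0^{-1}$, where $(f*h)(n)=\sum_{d\mid n}f(d)h(n/d)$ is Dirichlet convolution, $\sigma_0(n)$ is the number of divisors of $n$ and $\sigma_0^{-1}$ its Dirichlet-convolution inverse. The newform counting function $N^{\mathrm{new}}_{\Gamma_0(M)}$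 is said to be of cocompact type when $c_2^{\mathrm{new}}(M)=c_3^{\mathrm{new}}(M)=0$. *)

theory Defs
  imports "HOL-Analysis.Analysis" "HOL-Computational_Algebra.Computational_Algebra"
begin

definition Gamma0 :: "nat \<Rightarrow> (int ^ 2 ^ 2) set" where
  "Gamma0 M = {A. det A = 1 \<and> int M dvd A $ 2 $ 1}"

text \<open>The cusps of \<open>\<Gamma>\<^sub>0(M)\<close> are the points of the projective line over the rationals,
  represented by the type \<open>rat option\<close> with \<open>None\<close> as the point at infinity.\<close>

fun moebius :: "int ^ 2 ^ 2 \<Rightarrow> rat option \<Rightarrow> rat option" where
  "moebius A None =
     (if A $ 2 $ 1 = 0 then None else Some (of_int (A $ 1 $ 1) / of_int (A $ 2 $ 1)))"
| "moebius A (Some x) =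
     (if of_int (A $ 2 $ 1) * x + of_int (A $ 2 $ 2) = 0 then None
      else Some ((of_int (A $ 1 $ 1) * x + of_int (A $ 1 $ 2)) /
                 (of_int (A $ 2 $ 1) * x + of_int (A $ 2 $ 2))))"

definition cusp_equiv :: "nat \<Rightarrow> (rat option \<times> rat option) set" where
  "cusp_equiv M = {(x, y). \<exists>A\<in>Gamma0 M. y = moebius A x}"

definition num_cusps :: "nat \<Rightarrow> nat" where
  "num_cusps M = card (UNIV // cusp_equiv M)"

definition dirichlet_character :: "nat \<Rightarrow> (int \<Rightarrow> complex) \<Rightarrow> bool" where
  "dirichlet_character q \<psi> \<longleftrightarrow>
     (\<forall>a b. \<psi> (a * b) = \<psi> a * \<psi> b) \<and>
     (\<forall>a. \<psi> (a + int q) = \<psi> a) \<and>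
     (\<forall>a. \<psi> a \<noteq> 0 \<longleftrightarrow> coprime a (int q))"

text \<open>A character mod \<open>q\<close> is primitive if it is not induced by a character
  of smaller modulus \<open>d\<close> dividing \<open>q\<close>; the only character mod 1 is primitive.\<close>

definition primitive_character :: "nat \<Rightarrow> (int \<Rightarrow> complex) \<Rightarrow> bool" where
  "primitive_character q \<psi> \<longleftrightarrow>
     dirichlet_character q \<psi> \<and>
     \<not> (\<exists>d \<eta>. d dvd q \<and> d < q \<and> dirichlet_character d \<eta> \<and>
            (\<forall>a. coprime a (int q) \<longrightarrow> \<psi> a = \<eta> a))"

definition num_primitive_characters :: "nat \<Rightarrow> nat" where
  "num_primitive_characters q = card {\<psi>. primitive_character q \<psi>}"

definition log_A :: "nat \<Rightarrow> real" where
  "log_A M = (\<Sum>m | m dvd M. \<Sum>q | q dvd gcd m (M div m).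
     real (num_primitive_characters q) * ln (real q * real M / real (gcd m (M div m))))"

definition c2 :: "nat \<Rightarrow> real" where
  "c2 M = - (2 * real (num_cusps M) / pi)"

definition c3 :: "nat \<Rightarrow> real" where
  "c3 M = 1 / pi * ((2 - ln 2 + ln pi) * real (num_cusps M) - log_A M)"

definition dirichlet_conv :: "(nat \<Rightarrow> real) \<Rightarrow> (nat \<Rightarrow> real) \<Rightarrow> nat \<Rightarrow> real" where
  "dirichlet_conv f h n = (\<Sum>d | d dvd n. f d * h (n div d))"

text \<open>Arithmetic functions live on the positive integers; the junk value at 0 is fixed to be 0
  so that the inverse is unique whenever \<open>f 1 \<noteq> 0\<close>.\<close>

definition dirichlet_conv_inverse :: "(nat \<Rightarrow> real) \<Rightarrow> nat \<Rightarrow> real" where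
  "dirichlet_conv_inverse f =
     (THE g. g 0 = 0 \<and> (\<forall>n>0. dirichlet_conv f g n = (if n = 1 then 1 else 0)))"

definition sigma0 :: "nat \<Rightarrow> real" where
  "sigma0 n = real (card {d. d dvd n})"

definition c2_new :: "nat \<Rightarrow> real" where
  "c2_new = dirichlet_conv c2 (dirichlet_conv_inverse sigma0)"

definition c3_new :: "nat \<Rightarrow> real" where
  "c3_new = dirichlet_conv c3 (dirichlet_conv_inverse sigma0)"

definition new_cocompact_type :: "nat \<Rightarrow> bool" where
  "new_cocompact_type M \<longleftrightarrow> c2_new M = 0 \<and> c3_new M = 0"

end

theory Submission
  imports Defs "HOL-Number_Theory.Residues"
begin

text \<open>Replacing the logarithms in \<open>log A(M)\<close> by \<open>\<epsilon>\<close>-th powers yields a function of \<open>M\<close> that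
  is multiplicative for every \<open>\<epsilon>\<close>; its value at \<open>\<epsilon> = 0\<close> is the number of cusps and its
  derivative there is \<open>log A(M)\<close>. Convolution with the inverse of \<open>\<sigma>\<^sub>0\<close> preserves multiplicativity,
  so the new part is a product of local factors over the primes \<open>p\<close> dividing \<open>M\<close>, and being of
  cocompact type means that this product vanishes to order at least 2 at \<open>\<epsilon> = 0\<close>. The factor at
  \<open>p\<^sup>e\<close> vanishes at \<open>0\<close> exactly if \<open>e\<close> is odd or \<open>p\<^sup>e = 4\<close>, and all these zeros are simple; hence
  two such primes are needed and suffice.\<close>

section \<open>The number of Dirichlet characters\<close>

text \<open>The values of \<open>D\<close> are reached only through the identity that the sum of
  \<open>D q\<close> over \<open>q dvd g\<close> is \<open>totient g\<close>; hence the group theory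
  first: the units mod \<open>q\<close> have \<open>totient q\<close> characters, each induced by
  exactly one primitive character. This identity makes \<open>D\<close> multiplicative, it turns the
  sum over pairs at \<epsilon> = 0 into the sum of \<open>totient (gcd m (M div m))\<close>, which
  explicit invariants of cusps identify with \<open>num_cusps M\<close>, and it yields
  \<open>D 2 = 0\<close>, the source of the exceptional factor at 4. The deformation is there
  because \<open>log_A\<close> is not multiplicative: as a derivative of products it obeys a product
  rule instead. Once the new part of the cusp count vanishes, \<open>c3_new\<close> is a nonzero
  multiple of the new part of \<open>log_A\<close>, so the two conditions concern value and
  derivative of one function. The inverse of \<open>sigma0\<close> takes the values 1, -2, 1 at the
  powers 0, 1, 2 of a prime, so a local factor is a second difference in the exponent. The cusp
  count at an odd exponent is the mean of its two neighbours, which explains the zeros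
  there.\<close>

definition unit_subgroup :: "nat \<Rightarrow> int set \<Rightarrow> bool" where
  "unit_subgroup q H \<longleftrightarrow> 1 \<in> H \<and> (\<forall>a\<in>H. \<forall>b\<in>H. a * b \<in> H) \<and>
     (\<forall>a\<in>H. coprime a (int q)) \<and> (\<forall>a b. a \<in> H \<longrightarrow> [a = b] (mod int q) \<longrightarrow> b \<in> H)"

text \<open>Homomorphisms from \<open>H\<close> to the nonzero complex numbers, extended by 0. The
  extension makes each one a unique function on \<open>int\<close>, and for the full unit group it
  gives exactly the Dirichlet characters.\<close>

definition characters_on :: "nat \<Rightarrow> int set \<Rightarrow> (int \<Rightarrow> complex) set" where
  "characters_on q H = {\<psi>. (\<forall>a\<in>H. \<forall>b\<in>H. \<psi> (a * b) = \<psi> a * \<psi> b) \<and>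
     (\<forall>a b. [a = b] (mod int q) \<longrightarrow> \<psi> a = \<psi> b) \<and> (\<forall>a. \<psi> a \<noteq> 0 \<longleftrightarrow> a \<in> H)}"

text \<open>Natural exponents \<open>i\<close> suffice for the generated subgroup, since
  \<open>x\<close> has finite order mod \<open>q\<close>.\<close>

definition adjoin :: "nat \<Rightarrow> int set \<Rightarrow> int \<Rightarrow> int set" where
  "adjoin q H x = {y. \<exists>i. \<exists>h\<in>H. [y = x ^ i * h] (mod int q)}"

lemma euler_theorem_int:
  assumes "coprime a (int q)" "q > 0"
  shows "[a ^ totient q = 1] (mod int q)"
proof -
  have "coprime (nat (a mod int q)) q"
    using assms
    by (metis coprime_int_iff coprime_mod_left_iff nat_0_le of_nat_0_less_iff pos_mod_sign
        less_irrefl)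
  hence "[nat (a mod int q) ^ totient q = 1] (mod q)" by (rule euler_theorem)
  hence "[int (nat (a mod int q) ^ totient q) = int 1] (mod int q)"
    using cong_int_iff by blast
  hence "[(a mod int q) ^ totient q = 1] (mod int q)" using assms(2) by simp
  thus ?thesis by (simp add: cong_def power_mod)
qed

text \<open>A \<open>unit_subgroup\<close> is a union of residue classes; inverses come from Euler's
  theorem: \<open>a ^ (totient q - 1)\<close> lies in \<open>H\<close> and is inverse to
  \<open>a\<close> mod \<open>q\<close>.\<close>

lemma unit_subgroup_cancel:
  assumes H: "unit_subgroup q H" and "q > 0" "a \<in> H" "a * b \<in> H"
  shows "b \<in> H"
proof -
  have pw: "a ^ k \<in> H" for k
    using H \<open>a \<in> H\<close> by (induction k) (auto simp: unit_subgroup_def)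
  have "coprime a (int q)" using assms by (auto simp: unit_subgroup_def)
  hence "[a ^ totient q = 1] (mod int q)" using \<open>q > 0\<close> by (rule euler_theorem_int)
  moreover have "totient q = Suc (totient q - 1)" using \<open>q > 0\<close> by (simp add: Suc_leI)
  ultimately have "[a ^ (totient q - 1) * a = 1] (mod int q)"
    by (metis power_Suc2)
  hence "[a ^ (totient q - 1) * a * b = 1 * b] (mod int q)" by (rule cong_mult) simp
  moreover have "a ^ (totient q - 1) * (a * b) \<in> H"
    using H pw assms by (auto simp: unit_subgroup_def)
  ultimately show ?thesis
    using H by (auto simp: unit_subgroup_def mult.assoc)
qed

text \<open>A character of \<open>H\<close> extends to the group generated by \<open>H\<close> and \<open>x\<close> in exactly \<open>n\<close> ways, one for
  each \<open>n\<close>-th root of its value at \<open>x\<^sup>n\<close>; so enlarging \<open>H\<close> preserves the equality between the number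
  of characters and the order of the group.\<close>

locale adjunction =
  fixes q :: nat and H :: "int set" and x :: int and n :: nat
  assumes q: "q > 0" and H: "unit_subgroup q H" and x: "coprime x (int q)"
    and n_def: "n = (LEAST n. n > 0 \<and> x ^ n \<in> H)"
begin

lemma H_mult: "a \<in> H \<Longrightarrow> b \<in> H \<Longrightarrow> a * b \<in> H"
  and H_one: "1 \<in> H"
  and H_coprime: "a \<in> H \<Longrightarrow> coprime a (int q)"
  and H_cong: "a \<in> H \<Longrightarrow> [a = b] (mod int q) \<Longrightarrow> b \<in> H"
  using H unfolding unit_subgroup_def by blast+

lemma H_power: "a \<in> H \<Longrightarrow> a ^ k \<in> H"
  by (induction k) (auto simp: H_one H_mult)

lemma H_cancel: "a \<in> H \<Longrightarrow> a * b \<in> H \<Longrightarrow> b \<in> H"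
  using unit_subgroup_cancel[OF H q] by blast

lemma n: "n > 0" "x ^ n \<in> H"
proof -
  have "[1 = x ^ totient q] (mod int q)" using euler_theorem_int[OF x q] by (rule cong_sym)
  hence "x ^ totient q \<in> H" using H_one H_cong by blast
  hence "totient q > 0 \<and> x ^ totient q \<in> H" using q by simp
  from LeastI[of "\<lambda>n. n > 0 \<and> x ^ n \<in> H", OF this] show "n > 0" "x ^ n \<in> H"
    by (auto simp: n_def)
qed

text \<open>So \<open>n\<close> is the order of \<open>x\<close> in the quotient of the unit group
  by \<open>H\<close>.\<close>

lemma power_mem_iff: "x ^ i \<in> H \<longleftrightarrow> n dvd i"
proof
  assume "n dvd i"
  thus "x ^ i \<in> H" using H_power[OF n(2)] by (auto simp: power_mult)
next
  assume *: "x ^ i \<in> H"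
  have "x ^ i = (x ^ n) ^ (i div n) * x ^ (i mod n)"
    by (simp add: power_mult [symmetric] power_add [symmetric])
  hence "x ^ (i mod n) \<in> H" using * H_power[OF n(2)] H_cancel by metis
  moreover have "i mod n < n" using n by simp
  ultimately have "i mod n = 0"
    using not_less_Least[of "i mod n" "\<lambda>n. n > 0 \<and> x ^ n \<in> H"] by (auto simp: n_def)
  thus "n dvd i" by auto
qed

lemma coprime_power_x: "coprime (x ^ i) (int q)"
  using x by simp

text \<open>The unit \<open>x ^ i\<close> cancels, which leaves \<open>x ^ (j - i)\<close> in
  \<open>H\<close>. This one ambiguity controls both the order of the enlarged group and the
  well-definedness of extended characters.\<close>

lemma rep_unique:
  assumes "[x ^ i * h = x ^ j * h'] (mod int q)" "h \<in> H" "h' \<in> H" "i \<le> j"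
  obtains k where "j = i + n * k" "[h = x ^ (n * k) * h'] (mod int q)"
proof -
  have "x ^ j = x ^ i * x ^ (j - i)" using \<open>i \<le> j\<close> by (simp add: power_add [symmetric])
  hence "[x ^ i * h = x ^ i * (x ^ (j - i) * h')] (mod int q)"
    using assms(1) by (simp add: mult.assoc)
  hence c: "[h = x ^ (j - i) * h'] (mod int q)"
    using cong_mult_lcancel coprime_power_x by blast
  hence "x ^ (j - i) * h' \<in> H" using assms H_cong by blast
  hence "x ^ (j - i) \<in> H" using H_cancel[OF \<open>h' \<in> H\<close>] by (simp add: mult.commute)
  then obtain k where "j - i = n * k" by (auto simp: power_mem_iff)
  with c \<open>i \<le> j\<close> show ?thesis by (intro that[of k]) auto
qed

lemma rep_unique_less:
  assumes "[x ^ i * h = x ^ j * h'] (mod int q)" "h \<in> H" "h' \<in> H" "i < n" "j < n"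
  shows "i = j \<and> [h = h'] (mod int q)"
  using assms
proof (induction i j arbitrary: h h' rule: linorder_wlog)
  case (le i j)
  from rep_unique[OF le(2-4,1)] obtain k
    where k: "j = i + n * k" "[h = x ^ (n * k) * h'] (mod int q)" .
  have "k = 0" using k(1) le(6) by (cases k) auto
  with k show ?case by simp
next
  case (sym i j)
  from sym(1)[of h' h] sym(2-) show ?case by (auto simp: cong_sym_eq)
qed

lemma mem_adjoin_less:
  assumes "y \<in> adjoin q H x"
  obtains i h where "i < n" "h \<in> H" "[y = x ^ i * h] (mod int q)"
proof -
  from assms obtain i h where ih: "h \<in> H" "[y = x ^ i * h] (mod int q)"
    by (auto simp: adjoin_def)
  have "x ^ i = x ^ (i mod n) * (x ^ n) ^ (i div n)"
    by (simp add: power_mult [symmetric] power_add [symmetric])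
  with ih(2) have "[y = x ^ (i mod n) * ((x ^ n) ^ (i div n) * h)] (mod int q)"
    by (simp add: mult.assoc)
  moreover have "(x ^ n) ^ (i div n) * h \<in> H"
    using ih n H_power H_mult by blast
  ultimately show ?thesis using n by (intro that[of "i mod n"]) auto
qed

lemma adjoinI: "h \<in> H \<Longrightarrow> x ^ i * h \<in> adjoin q H x"
  unfolding adjoin_def using cong_refl by blast

lemma subset_adjoin: "H \<subseteq> adjoin q H x"
  using adjoinI[of _ 0] by auto

lemma x_mem_adjoin: "x \<in> adjoin q H x"
  using adjoinI[OF H_one, of 1] by auto

lemma unit_subgroup_adjoin: "unit_subgroup q (adjoin q H x)"
  unfolding unit_subgroup_def
proof (intro conjI allI ballI impI)
  show "1 \<in> adjoin q H x" using subset_adjoin H_one by blast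
next
  fix a b assume "a \<in> adjoin q H x" "b \<in> adjoin q H x"
  then obtain i h j h' where h: "h \<in> H" "h' \<in> H" and
    "[a = x ^ i * h] (mod int q)" "[b = x ^ j * h'] (mod int q)"
    by (auto simp: adjoin_def)
  hence "[a * b = (x ^ i * h) * (x ^ j * h')] (mod int q)" by (intro cong_mult)
  also have "(x ^ i * h) * (x ^ j * h') = x ^ (i + j) * (h * h')" by (simp add: power_add)
  finally show "a * b \<in> adjoin q H x" using h H_mult unfolding adjoin_def by blast
next
  fix a assume "a \<in> adjoin q H x"
  then obtain i h where h: "h \<in> H" "[a = x ^ i * h] (mod int q)" by (auto simp: adjoin_def)
  have "coprime (x ^ i * h) (int q)" using h H_coprime coprime_power_x by simp
  thus "coprime a (int q)" using h(2) cong_imp_coprime cong_sym by blast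
next
  fix a b assume "a \<in> adjoin q H x" "[a = b] (mod int q)"
  thus "b \<in> adjoin q H x" unfolding adjoin_def using cong_trans cong_sym by blast
qed

lemma card_adjoin:
  "card (adjoin q H x \<inter> {0..<int q}) = n * card (H \<inter> {0..<int q})"
proof -
  have "bij_betw (\<lambda>(i, h). (x ^ i * h) mod int q) ({..<n} \<times> (H \<inter> {0..<int q}))
          (adjoin q H x \<inter> {0..<int q})"
    unfolding bij_betw_def
  proof
    show "inj_on (\<lambda>(i, h). (x ^ i * h) mod int q) ({..<n} \<times> (H \<inter> {0..<int q}))"
    proof (rule inj_onI, clarify)
      fix i h j h'
      assume "i < n" "j < n" "h \<in> H" "h' \<in> H" "h \<in> {0..<int q}" "h' \<in> {0..<int q}"
        "(x ^ i * h) mod int q = (x ^ j * h') mod int q"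
      thus "i = j \<and> h = h'" using rep_unique_less[of i h j h']
        by (auto simp: cong_def)
    qed
    show "(\<lambda>(i, h). (x ^ i * h) mod int q) ` ({..<n} \<times> (H \<inter> {0..<int q})) =
            adjoin q H x \<inter> {0..<int q}"
    proof (intro equalityI subsetI)
      fix y assume "y \<in> (\<lambda>(i, h). (x ^ i * h) mod int q) ` ({..<n} \<times> (H \<inter> {0..<int q}))"
      then obtain i h where "h \<in> H" "y = (x ^ i * h) mod int q" by auto
      thus "y \<in> adjoin q H x \<inter> {0..<int q}" using q by (auto simp: adjoin_def cong_def)
    next
      fix y assume y: "y \<in> adjoin q H x \<inter> {0..<int q}"
      then obtain i h where ih: "i < n" "h \<in> H" "[y = x ^ i * h] (mod int q)"
        using mem_adjoin_less by blast
      have "y = (x ^ i * (h mod int q)) mod int q"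
        using ih(3) y by (simp add: cong_def mod_mult_right_eq)
      moreover have "h mod int q \<in> H \<inter> {0..<int q}"
        using H_cong[OF ih(2), of "h mod int q"] q by (auto simp: cong_def)
      ultimately show "y \<in> (\<lambda>(i, h). (x ^ i * h) mod int q) ` ({..<n} \<times> (H \<inter> {0..<int q}))"
        using ih(1) by (intro image_eqI[where x = "(i, h mod int q)"]) auto
    qed
  qed
  from bij_betw_same_card[OF this] show ?thesis by (simp add: card_cartesian_product)
qed

lemma char_mult: "\<psi> \<in> characters_on q H \<Longrightarrow> a \<in> H \<Longrightarrow> b \<in> H \<Longrightarrow> \<psi> (a * b) = \<psi> a * \<psi> b"
  and char_cong: "\<psi> \<in> characters_on q H \<Longrightarrow> [a = b] (mod int q) \<Longrightarrow> \<psi> a = \<psi> b"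
  and char_nz: "\<psi> \<in> characters_on q H \<Longrightarrow> \<psi> a \<noteq> 0 \<longleftrightarrow> a \<in> H"
  unfolding characters_on_def by blast+

lemma char_one: "\<psi> \<in> characters_on q H \<Longrightarrow> \<psi> 1 = 1"
  using char_mult[of \<psi> 1 1] char_nz[of \<psi> 1] H_one by auto

lemma char_power: "\<psi> \<in> characters_on q H \<Longrightarrow> a \<in> H \<Longrightarrow> \<psi> (a ^ k) = \<psi> a ^ k"
  by (induction k) (auto simp: char_one char_mult H_power)

text \<open>Two representations differ by moving a power of \<open>x ^ n\<close> between the two
  factors, and the root condition on \<open>z\<close> says precisely that this does not change the
  value.\<close>

lemma extension_well_defined:
  assumes chi: "\<psi> \<in> characters_on q H" and z: "z ^ n = \<psi> (x ^ n)"
    and "[x ^ i * h = x ^ j * h'] (mod int q)" "h \<in> H" "h' \<in> H"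
  shows "z ^ i * \<psi> h = z ^ j * \<psi> h'"
  using assms(3-)
proof (induction i j arbitrary: h h' rule: linorder_wlog)
  case (le i j)
  from rep_unique[OF le(2-4,1)] obtain k
    where k: "j = i + n * k" "[h = x ^ (n * k) * h'] (mod int q)" .
  have "\<psi> h = \<psi> ((x ^ n) ^ k * h')" using char_cong[OF chi k(2)] by (simp add: power_mult)
  also have "\<dots> = \<psi> (x ^ n) ^ k * \<psi> h'"
    using le char_mult[OF chi] char_power[OF chi] n H_power by simp
  also have "\<dots> = z ^ (n * k) * \<psi> h'" by (simp add: z[symmetric] power_mult)
  finally show ?case by (simp add: k(1) power_add)
next
  case (sym i j)
  from sym(1)[of h' h] sym(2-) show ?case by (auto simp: cong_sym_eq)
qed

text \<open>A character of the larger group is recorded by its restriction to \<open>H\<close>,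
  again extended by 0, and its value at the new generator.\<close>

lemma bij_betw_characters_adjoin:
  "bij_betw (\<lambda>\<psi>. (\<lambda>a. if a \<in> H then \<psi> a else 0, \<psi> x)) (characters_on q (adjoin q H x))
     (SIGMA \<psi>:characters_on q H. {z. z ^ n = \<psi> (x ^ n)})"
  unfolding bij_betw_def
proof
  let ?A = "adjoin q H x"
  \<comment> \<open>Adjoining 1 changes nothing; the interpretation only makes the facts of the
    locale available for \<open>?A\<close> in place of \<open>H\<close>.\<close>
  interpret A: adjunction q ?A 1 "LEAST n. n > 0 \<and> 1 ^ n \<in> ?A"
    using q unit_subgroup_adjoin by unfold_locales auto
  have decomp: "\<psi> (x ^ i * h) = \<psi> x ^ i * \<psi> h"
    if "\<psi> \<in> characters_on q ?A" "h \<in> H" for \<psi> i h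
    using that A.char_mult[of \<psi> "x ^ i" h] A.char_power[of \<psi> x i] x_mem_adjoin subset_adjoin
      A.H_power by auto
  show "inj_on (\<lambda>\<psi>. (\<lambda>a. if a \<in> H then \<psi> a else 0, \<psi> x)) (characters_on q ?A)"
  proof (rule inj_onI)
    fix \<psi> \<psi>' assume *: "\<psi> \<in> characters_on q ?A" "\<psi>' \<in> characters_on q ?A"
      "(\<lambda>a. if a \<in> H then \<psi> a else 0, \<psi> x) = (\<lambda>a. if a \<in> H then \<psi>' a else 0, \<psi>' x)"
    have eqH: "\<psi> h = \<psi>' h" if "h \<in> H" for h
      using *(3) that by (auto dest!: fun_cong[of _ _ h])
    show "\<psi> = \<psi>'"
    proof
      fix y
      show "\<psi> y = \<psi>' y"
      proof (cases "y \<in> ?A")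
        case True
        then obtain i h where ih: "h \<in> H" "[y = x ^ i * h] (mod int q)"
          by (auto simp: adjoin_def)
        have "\<psi> y = \<psi> x ^ i * \<psi> h" using A.char_cong[OF *(1) ih(2)] decomp[OF *(1) ih(1)] by simp
        moreover have "\<psi>' y = \<psi>' x ^ i * \<psi>' h"
          using A.char_cong[OF *(2) ih(2)] decomp[OF *(2) ih(1)] by simp
        ultimately show ?thesis using *(3) eqH[OF ih(1)] by simp
      next
        case False
        thus ?thesis using A.char_nz *(1,2) by metis
      qed
    qed
  qed
  show "(\<lambda>\<psi>. (\<lambda>a. if a \<in> H then \<psi> a else 0, \<psi> x)) ` characters_on q ?A =
    (SIGMA \<psi>:characters_on q H. {z. z ^ n = \<psi> (x ^ n)})" (is "?f ` _ = ?S")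
  proof (intro equalityI subsetI)
    fix p assume "p \<in> ?f ` characters_on q ?A"
    then obtain \<psi> where chi: "\<psi> \<in> characters_on q ?A" and p: "p = ?f \<psi>" by blast
    have "(\<lambda>a. if a \<in> H then \<psi> a else 0) \<in> characters_on q H"
      unfolding characters_on_def
    proof (intro CollectI conjI ballI allI impI)
      fix a b assume "a \<in> H" "b \<in> H"
      thus "(if a * b \<in> H then \<psi> (a * b) else 0) =
              (if a \<in> H then \<psi> a else 0) * (if b \<in> H then \<psi> b else 0)"
        using A.char_mult[OF chi] subset_adjoin H_mult by auto
    next
      fix a b assume ab: "[a = b] (mod int q)"
      hence "a \<in> H \<longleftrightarrow> b \<in> H" using H_cong cong_sym by blast
      thus "(if a \<in> H then \<psi> a else 0) = (if b \<in> H then \<psi> b else 0)"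
        using A.char_cong[OF chi ab] by simp
    next
      fix a
      show "(if a \<in> H then \<psi> a else 0) \<noteq> 0 \<longleftrightarrow> a \<in> H"
        using A.char_nz[OF chi] subset_adjoin by auto
    qed
    moreover have "\<psi> x ^ n = \<psi> (x ^ n)" using A.char_power[OF chi x_mem_adjoin] by simp
    ultimately show "p \<in> ?S" using n p by auto
  next
    fix p assume "p \<in> ?S"
    then obtain \<psi> z where p: "p = (\<psi>, z)" and chi: "\<psi> \<in> characters_on q H"
      and z: "z ^ n = \<psi> (x ^ n)" by auto
    have z0: "z \<noteq> 0" using z n char_nz[OF chi, of "x ^ n"] by (auto simp: power_0_left)
    \<comment> \<open>An arbitrary representation of \<open>y\<close>; by
      \<open>extension_well_defined\<close> the value of \<open>\<omega>\<close> does not depend on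
      it.\<close>
    define I where "I y = (SOME ih. snd ih \<in> H \<and> [y = x ^ (fst ih) * snd ih] (mod int q))"
      for y
    define \<omega> where "\<omega> y = (if y \<in> ?A then z ^ fst (I y) * \<psi> (snd (I y)) else 0)" for y
    have psi: "\<omega> y = z ^ i * \<psi> h" if "[y = x ^ i * h] (mod int q)" "h \<in> H" for y i h
    proof -
      have y: "y \<in> ?A" using that unfolding adjoin_def by blast
      have "snd (I y) \<in> H \<and> [y = x ^ (fst (I y)) * snd (I y)] (mod int q)"
        unfolding I_def using that
          someI[of "\<lambda>ih. snd ih \<in> H \<and> [y = x ^ (fst ih) * snd ih] (mod int q)" "(i, h)"]
        by simp
      moreover from this have "[x ^ (fst (I y)) * snd (I y) = x ^ i * h] (mod int q)"
        using cong_trans[OF cong_sym that(1)] by blast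
      ultimately show ?thesis
        using extension_well_defined[OF chi z, of "fst (I y)" "snd (I y)" i h] that y
        by (simp add: \<omega>_def)
    qed
    have "\<omega> \<in> characters_on q ?A"
      unfolding characters_on_def
    proof (intro CollectI conjI ballI allI impI)
      fix a b assume "a \<in> ?A" "b \<in> ?A"
      then obtain i h j h' where h: "h \<in> H" "h' \<in> H" and
        ab: "[a = x ^ i * h] (mod int q)" "[b = x ^ j * h'] (mod int q)"
        by (auto simp: adjoin_def)
      hence "[a * b = (x ^ i * h) * (x ^ j * h')] (mod int q)" by (intro cong_mult)
      also have "(x ^ i * h) * (x ^ j * h') = x ^ (i + j) * (h * h')" by (simp add: power_add)
      finally have "\<omega> (a * b) = z ^ (i + j) * \<psi> (h * h')" using psi h H_mult by blast
      thus "\<omega> (a * b) = \<omega> a * \<omega> b"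
        using psi[OF ab(1)] psi[OF ab(2)] h char_mult[OF chi] by (simp add: power_add)
    next
      fix a b assume ab: "[a = b] (mod int q)"
      show "\<omega> a = \<omega> b"
      proof (cases "a \<in> ?A")
        case True
        then obtain i h where h: "h \<in> H" "[a = x ^ i * h] (mod int q)" by (auto simp: adjoin_def)
        moreover from this have "[b = x ^ i * h] (mod int q)" using ab cong_trans cong_sym by blast
        ultimately show ?thesis using psi by simp
      next
        case False
        moreover from this have "b \<notin> ?A" using A.H_cong ab cong_sym by blast
        ultimately show ?thesis by (simp add: \<omega>_def)
      qed
    next
      fix a
      show "\<omega> a \<noteq> 0 \<longleftrightarrow> a \<in> ?A"
      proof
        assume "a \<in> ?A"
        then obtain i h where h: "h \<in> H" "[a = x ^ i * h] (mod int q)" by (auto simp: adjoin_def)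
        thus "\<omega> a \<noteq> 0" using psi z0 char_nz[OF chi] by simp
      qed (simp add: \<omega>_def split: if_splits)
    qed
    moreover have "?f \<omega> = p"
    proof -
      have "(if a \<in> H then \<omega> a else 0) = \<psi> a" for a
        using psi[of a 0 a] char_nz[OF chi, of a] by auto
      moreover have "\<omega> x = z" using psi[of x 1 1] H_one char_one[OF chi] by simp
      ultimately show ?thesis by (simp add: p)
    qed
    ultimately show "p \<in> ?f ` characters_on q ?A" by blast
  qed
qed

lemma card_characters_adjoin:
  assumes "finite (characters_on q H)"
  shows "finite (characters_on q (adjoin q H x))"
    and "card (characters_on q (adjoin q H x)) = n * card (characters_on q H)"
proof -
  \<comment> \<open>A nonzero complex number has exactly \<open>n\<close> roots of order
    \<open>n\<close>, and \<open>\<psi> (x ^ n)\<close> is nonzero because \<open>x ^ n\<close> lies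
    in \<open>H\<close>.\<close>
  have c: "card {z. z ^ n = \<psi> (x ^ n)} = n" if "\<psi> \<in> characters_on q H" for \<psi>
    using that n char_nz card_nth_roots by blast
  hence f: "finite {z. z ^ n = \<psi> (x ^ n)}" if "\<psi> \<in> characters_on q H" for \<psi>
    using that n(1) card_ge_0_finite by force
  show "finite (characters_on q (adjoin q H x))"
    using bij_betw_finite[OF bij_betw_characters_adjoin] assms f by (auto intro: finite_SigmaI)
  have "card (characters_on q (adjoin q H x)) = (\<Sum>\<psi>\<in>characters_on q H. card {z. z ^ n = \<psi> (x ^ n)})"
    using bij_betw_same_card[OF bij_betw_characters_adjoin] assms f by simp
  thus "card (characters_on q (adjoin q H x)) = n * card (characters_on q H)"
    using c by simp
qed

end

section \<open>Characters of the full unit group\<close>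

lemma card_coprime_residues:
  "card ({a. coprime a (int q)} \<inter> {0..<int q}) = totient q"
proof (cases "q \<le> 1")
  case True
  hence "q = 0 \<or> q = 1" by auto
  thus ?thesis by (elim disjE) (simp_all add: Int_absorb1)
next
  case False
  have "bij_betw int (totatives q) ({a. coprime a (int q)} \<inter> {0..<int q})"
  proof (rule bij_betwI[where g = nat])
    show "int \<in> totatives q \<rightarrow> {a. coprime a (int q)} \<inter> {0..<int q}"
      using False totatives_less[of _ q] by (auto simp: in_totatives_iff)
    show "nat \<in> {a. coprime a (int q)} \<inter> {0..<int q} \<rightarrow> totatives q"
    proof
      fix a assume a: "a \<in> {a. coprime a (int q)} \<inter> {0..<int q}"
      hence "a \<noteq> 0" using False by auto
      with a have "coprime (nat a) q" "0 < nat a" by (auto simp flip: coprime_int_iff)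
      with a show "nat a \<in> totatives q" by (auto simp: in_totatives_iff nat_le_iff)
    qed
  qed auto
  from bij_betw_same_card[OF this] show ?thesis by (simp add: totient_def)
qed

text \<open>Among the subgroups with as many characters as elements, one of largest order is
  everything: adjoining a missing unit multiplies both counts by the same \<open>n\<close>, which is
  at least 2. The trivial subgroup \<open>?H0\<close> shows that such subgroups exist.\<close>

theorem card_characters_on_units:
  assumes q: "q > 0"
  shows "finite (characters_on q {a. coprime a (int q)})"
    and "card (characters_on q {a. coprime a (int q)}) = totient q"
proof -
  let ?r = "\<lambda>H. card (H \<inter> {0..<int q})"
  let ?P = "\<lambda>H. unit_subgroup q H \<and> finite (characters_on q H) \<and> card (characters_on q H) = ?r H"
  let ?H0 = "{a. [1 = a] (mod int q)}"
  have sub0: "unit_subgroup q ?H0"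
    unfolding unit_subgroup_def
  proof (intro conjI ballI allI impI)
    fix a b assume "a \<in> ?H0" "b \<in> ?H0"
    thus "a * b \<in> ?H0" using cong_mult[of 1 a "int q" 1 b] by simp
  next
    fix a assume "a \<in> ?H0"
    thus "coprime a (int q)" using cong_imp_coprime[of 1 a] by simp
  next
    fix a b assume "a \<in> ?H0" "[a = b] (mod int q)"
    thus "b \<in> ?H0" using cong_trans by blast
  qed auto
  have char0: "characters_on q ?H0 = {\<lambda>a. if [1 = a] (mod int q) then 1 else 0}"
  proof (intro equalityI subsetI)
    fix \<psi> assume *: "\<psi> \<in> characters_on q ?H0"
    interpret A: adjunction q ?H0 1 "LEAST n. n > 0 \<and> 1 ^ n \<in> ?H0"
      using q sub0 by unfold_locales auto
    have "\<psi> a = (if [1 = a] (mod int q) then 1 else 0)" for a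
      using A.char_one[OF *] A.char_cong[OF *, of 1 a] A.char_nz[OF *, of a] by auto
    thus "\<psi> \<in> {\<lambda>a. if [1 = a] (mod int q) then 1 else 0}" by auto
  next
    fix \<psi> :: "int \<Rightarrow> complex" assume "\<psi> \<in> {\<lambda>a. if [1 = a] (mod int q) then 1 else 0}"
    moreover have "a * b \<in> ?H0" if "a \<in> ?H0" "b \<in> ?H0" for a b
      using that sub0 by (auto simp: unit_subgroup_def)
    ultimately show "\<psi> \<in> characters_on q ?H0"
      by (auto simp: characters_on_def dest: cong_trans cong_sym)
  qed
  have "?H0 \<inter> {0..<int q} = {1 mod int q}" using q by (auto simp: cong_def)
  hence P0: "?P ?H0" using sub0 char0 by simp
  have bound: "?r H \<le> q" for H
    using card_mono[of "{0..<int q}" "H \<inter> {0..<int q}"] by simp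
  from ex_has_greatest_nat[of ?P, OF P0, of ?r "Suc q"] obtain H
    where H: "?P H" and max: "\<And>H'. ?P H' \<Longrightarrow> ?r H' \<le> ?r H"
    using bound by (metis (no_types, lifting) less_Suc_eq_le)
  have "H = {a. coprime a (int q)}"
  proof (rule ccontr)
    assume "H \<noteq> {a. coprime a (int q)}"
    then obtain x where x: "coprime x (int q)" "x \<notin> H"
      using H by (auto simp: unit_subgroup_def)
    interpret A: adjunction q H x "LEAST n. n > 0 \<and> x ^ n \<in> H"
      using q H x by unfold_locales auto
    let ?n = "LEAST n. n > 0 \<and> x ^ n \<in> H"
    have "?n \<noteq> 1" using A.n x(2) by (metis power_one_right)
    hence n: "?n \<ge> 2" using A.n(1) by linarith
    have "?P (adjoin q H x)"
      using A.unit_subgroup_adjoin A.card_characters_adjoin A.card_adjoin H by simp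
    from max[OF this] have "?n * ?r H \<le> ?r H" by (simp add: A.card_adjoin)
    moreover have "1 mod int q \<in> H \<inter> {0..<int q}"
      using A.H_cong[OF A.H_one, of "1 mod int q"] q by (auto simp: cong_def)
    hence "?r H > 0" by (auto simp: card_gt_0_iff)
    ultimately show False using n by auto
  qed
  with H card_coprime_residues show "finite (characters_on q {a. coprime a (int q)})"
    and "card (characters_on q {a. coprime a (int q)}) = totient q" by auto
qed

section \<open>Conductors\<close>

lemma coprime_add_modulus: "coprime (a + m) m \<longleftrightarrow> coprime a (m :: int)"
  by (simp add: coprime_iff_gcd_eq_1)

lemma periodic_add_mult:
  fixes f :: "int \<Rightarrow> 'a"
  assumes "\<And>a. f (a + q) = f a"
  shows "f (a + q * k) = f a"
proof (induction k arbitrary: a rule: int_induct[of _ 0])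
  case base
  show ?case by simp
next
  case (step1 i)
  from step1(2)[of "a + q"] show ?case using assms[of a] by (simp add: algebra_simps)
next
  case (step2 i)
  from step2(2)[of "a - q"] show ?case using assms[of "a - q"] by (simp add: algebra_simps)
qed

lemma dirichlet_character_mult: "dirichlet_character q \<psi> \<Longrightarrow> \<psi> (a * b) = \<psi> a * \<psi> b"
  and dirichlet_character_nz: "dirichlet_character q \<psi> \<Longrightarrow> \<psi> a \<noteq> 0 \<longleftrightarrow> coprime a (int q)"
  unfolding dirichlet_character_def by blast+

lemma dirichlet_character_cong:
  "dirichlet_character q \<psi> \<Longrightarrow> [a = b] (mod int q) \<Longrightarrow> \<psi> a = \<psi> b"
  using periodic_add_mult[of \<psi> "int q"] by (auto simp: dirichlet_character_def cong_iff_lin)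

lemma dirichlet_character_one: "dirichlet_character q \<psi> \<Longrightarrow> \<psi> 1 = 1"
  using dirichlet_character_mult[of q \<psi> 1 1] dirichlet_character_nz[of q \<psi> 1] by auto

lemma dirichlet_characters_eq:
  "{\<psi>. dirichlet_character q \<psi>} = characters_on q {a. coprime a (int q)}"
proof (intro equalityI subsetI)
  fix \<psi> assume "\<psi> \<in> {\<psi>. dirichlet_character q \<psi>}"
  thus "\<psi> \<in> characters_on q {a. coprime a (int q)}"
    by (auto simp: characters_on_def dirichlet_character_mult dirichlet_character_nz
        intro: dirichlet_character_cong)
next
  fix \<psi> assume *: "\<psi> \<in> characters_on q {a. coprime a (int q)}"
  hence nz: "\<psi> a \<noteq> 0 \<longleftrightarrow> coprime a (int q)" for a by (auto simp: characters_on_def)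
  have "\<psi> (a * b) = \<psi> a * \<psi> b" for a b
  proof (cases "coprime a (int q) \<and> coprime b (int q)")
    case True
    thus ?thesis using * by (auto simp: characters_on_def)
  next
    case False
    hence "\<not> coprime (a * b) (int q)" by auto
    with False nz show ?thesis by (metis mult_eq_0_iff)
  qed
  moreover have "\<psi> (a + int q) = \<psi> a" for a
  proof -
    have "\<And>a b. [a = b] (mod int q) \<Longrightarrow> \<psi> a = \<psi> b"
      using * unfolding characters_on_def by blast
    moreover have "[a + int q = a] (mod int q)" by (simp add: cong_def)
    ultimately show ?thesis by blast
  qed
  ultimately show "\<psi> \<in> {\<psi>. dirichlet_character q \<psi>}"
    using nz by (simp add: dirichlet_character_def)
qed

lemma
  assumes "q > 0"
  shows finite_dirichlet_characters: "finite {\<psi>. dirichlet_character q \<psi>}"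
    and card_dirichlet_characters: "card {\<psi>. dirichlet_character q \<psi>} = totient q"
  using card_characters_on_units[OF assms] by (simp_all add: dirichlet_characters_eq)

text \<open>With \<open>k\<close> the product of the primes of \<open>q\<close> that do not divide
  \<open>a\<close>, each prime of \<open>q\<close> divides exactly one of \<open>a\<close> and
  \<open>d * k\<close>, hence not their sum.\<close>

lemma ex_coprime_shift:
  fixes a d q :: int
  assumes "coprime a d" "q \<noteq> 0"
  shows "\<exists>k. coprime (a + d * k) q"
proof -
  let ?S = "{p \<in> prime_factors q. \<not> p dvd a}"
  let ?k = "\<Prod>p\<in>?S. p"
  have "coprime (a + d * ?k) q"
  proof (rule ccontr)
    assume "\<not> coprime (a + d * ?k) q"
    hence "\<bar>gcd (a + d * ?k) q\<bar> \<noteq> 1" by (simp add: coprime_iff_gcd_eq_1)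
    then obtain p where p: "prime p" "p dvd a + d * ?k" "p dvd q"
      by (elim prime_factor_int) simp
    hence pq: "p \<in> prime_factors q" using \<open>q \<noteq> 0\<close> by (auto simp: prime_factors_dvd)
    show False
    proof (cases "p dvd a")
      case True
      hence "p dvd d * ?k" using p(2) dvd_add_right_iff by blast
      hence "p dvd d \<or> p dvd ?k" using p(1) prime_dvd_mult_iff by blast
      moreover have "\<not> p dvd d"
        using True assms(1) p(1) by (metis coprime_common_divisor not_prime_unit)
      moreover have "\<not> p dvd ?k"
      proof
        assume "p dvd ?k"
        then obtain p' where p': "p' \<in> ?S" "p dvd p'"
          using prime_dvd_prod_iff[of ?S p "\<lambda>p. p"] p(1) by auto
        hence "p = p'" using p(1) primes_dvd_imp_eq by (auto simp: in_prime_factors_iff)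
        with p' True show False by simp
      qed
      ultimately show False by blast
    next
      case False
      hence "p dvd ?k" using pq by (intro dvd_prodI) auto
      hence "p dvd a" using p(2) by (metis dvd_add_left_iff dvd_mult)
      with False show False by blast
    qed
  qed
  thus ?thesis by blast
qed

lemma ex_cong_coprime:
  assumes "coprime a (int d)" "q > 0"
  obtains b where "[b = a] (mod int d)" "coprime b (int q)"
proof -
  obtain k where k: "coprime (a + int d * k) (int q)"
    using ex_coprime_shift[OF assms(1), of "int q"] assms(2) by auto
  moreover have "[a + int d * k = a] (mod int d)" by (simp add: cong_def)
  ultimately show ?thesis using that by blast
qed

text \<open>A character that is trivial on the kernel of reduction from the units mod
  \<open>d\<close> to the units mod \<open>g\<close> factors through the image. Reduction is onto by
  \<open>ex_cong_coprime\<close>, so \<open>\<eta>\<close> can be read off from a lift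
  \<open>L a\<close>.\<close>

lemma character_descends:
  assumes psi: "dirichlet_character d \<psi>" and "d > 0" and "g dvd d"
    and triv: "\<And>a. coprime a (int d) \<Longrightarrow> [a = 1] (mod int g) \<Longrightarrow> \<psi> a = 1"
  shows "\<exists>\<eta>. dirichlet_character g \<eta> \<and> (\<forall>a. coprime a (int d) \<longrightarrow> \<psi> a = \<eta> a)"
proof -
  have gd: "[a = b] (mod int d) \<Longrightarrow> [a = b] (mod int g)" for a b
    using \<open>g dvd d\<close> cong_dvd_modulus[of a b "int d" "int g"] by simp
  have wd: "\<psi> b = \<psi> b'"
    if b: "coprime b (int d)" "coprime b' (int d)" "[b = b'] (mod int g)" for b b'
  proof -
    obtain c where c: "[b' * c = 1] (mod int d)" using cong_solve_coprime_int b(2) by blast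
    hence cc: "coprime c (int d)"
      by (metis coprime_iff_invertible_int mult.commute)
    have "[b * c = b' * c] (mod int g)" using b(3) by (intro cong_mult) auto
    also have "[b' * c = 1] (mod int g)" using gd c by blast
    finally have "\<psi> (b * c) = 1" using triv b(1) cc by simp
    moreover have "\<psi> (b' * c) = 1" using triv b(2) cc gd c by simp
    ultimately have "\<psi> b * \<psi> c = \<psi> b' * \<psi> c" using dirichlet_character_mult[OF psi] by simp
    moreover have "\<psi> c \<noteq> 0" using dirichlet_character_nz[OF psi] cc by blast
    ultimately show ?thesis by simp
  qed
  define L where "L a = (SOME b. [b = a] (mod int g) \<and> coprime b (int d))" for a
  define \<eta> where "\<eta> a = (if coprime a (int g) then \<psi> (L a) else 0)" for a
  have L: "[L a = a] (mod int g) \<and> coprime (L a) (int d)" if "coprime a (int g)" for a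
    unfolding L_def by (rule someI_ex) (use ex_cong_coprime[OF that \<open>d > 0\<close>] in blast)
  have eta: "\<eta> a = \<psi> b" if "[b = a] (mod int g)" "coprime b (int d)" for a b
  proof -
    have "coprime b (int g)" using that(2) \<open>g dvd d\<close> by (meson coprime_divisors dvd_refl of_nat_dvd_iff)
    hence "coprime a (int g)" using that(1) cong_imp_coprime by blast
    with L[of a] that wd[of "L a" b] show ?thesis
      by (auto simp: \<eta>_def intro: cong_trans cong_sym)
  qed
  have "dirichlet_character g \<eta>"
    unfolding dirichlet_character_def
  proof (intro conjI allI)
    fix a b
    show "\<eta> (a * b) = \<eta> a * \<eta> b"
    proof (cases "coprime a (int g) \<and> coprime b (int g)")
      case True
      hence "\<eta> (a * b) = \<psi> (L a * L b)"
        using L[of a] L[of b] by (intro eta cong_mult) auto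
      thus ?thesis using True by (simp add: \<eta>_def dirichlet_character_mult[OF psi])
    next
      case False
      thus ?thesis by (auto simp: \<eta>_def)
    qed
  next
    fix a
    show "\<eta> (a + int g) = \<eta> a"
    proof (cases "coprime a (int g)")
      case True
      hence "\<eta> (a + int g) = \<psi> (L a)"
        using L[of a] by (intro eta) (auto simp: cong_def)
      thus ?thesis using True by (simp add: \<eta>_def)
    next
      case False
      thus ?thesis by (simp add: \<eta>_def coprime_add_modulus)
    qed
  next
    fix a
    show "\<eta> a \<noteq> 0 \<longleftrightarrow> coprime a (int g)"
      using L[of a] dirichlet_character_nz[OF psi] by (auto simp: \<eta>_def)
  qed
  moreover have "\<psi> a = \<eta> a" if "coprime a (int d)" for a using eta[of a a] that by simp
  ultimately show ?thesis by blast
qed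

text \<open>It is enough that \<open>\<eta>1\<close> descends to the gcd of the moduli, since
  primitivity then forces this gcd to be \<open>d1\<close>. For \<open>a\<close> congruent to 1
  modulo the gcd, the Chinese remainder theorem gives \<open>b\<close> congruent to \<open>a\<close>
  mod \<open>d1\<close> and to 1 mod \<open>d2\<close>, and comparing the two characters there
  yields 1.\<close>

lemma primitive_modulus_dvd:
  assumes prim: "primitive_character d1 \<eta>1" and eta2: "dirichlet_character d2 \<eta>2"
    and d: "d1 dvd q" "d2 dvd q" "q > 0"
    and eq: "\<And>a. coprime a (int q) \<Longrightarrow> \<eta>1 a = \<eta>2 a"
  shows "d1 dvd d2"
proof -
  have eta1: "dirichlet_character d1 \<eta>1" using prim by (simp add: primitive_character_def)
  have pos: "d1 > 0" "d2 > 0" using d by (auto intro: Nat.gr0I)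
  let ?g = "gcd d1 d2"
  have "\<eta>1 a = 1" if a: "coprime a (int d1)" "[a = 1] (mod int ?g)" for a
  proof -
    have "\<exists>k. [int d1 * k = 1 - a] (mod int d2)"
      using a(2) by (intro cong_solve_dvd_int)
        (simp add: cong_iff_dvd_diff dvd_diff_commute flip: gcd_int_int_eq)
    then obtain k where k: "[int d1 * k = 1 - a] (mod int d2)" ..
    define b where "b = a + int d1 * k"
    have b1: "[b = a] (mod int d1)" by (simp add: b_def cong_def)
    have "[b = a + (1 - a)] (mod int d2)" unfolding b_def using k by (intro cong_add) auto
    hence b2: "[b = 1] (mod int d2)" by simp
    have "coprime b (int d1)" using a(1) b1 cong_imp_coprime cong_sym by blast
    moreover have "coprime b (int d2)" using b2 cong_imp_coprime[of 1 b] by (simp add: cong_sym_eq)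
    ultimately have "coprime b (int (d1 * d2))" by simp
    \<comment> \<open>The two characters are known to agree only on integers coprime to
      \<open>q\<close>, so \<open>b\<close> is moved to such a \<open>c\<close> inside its class mod
      \<open>d1 * d2\<close>.\<close>
    then obtain c where c: "[c = b] (mod int (d1 * d2))" "coprime c (int q)"
      using ex_cong_coprime d(3) by blast
    have c1: "[c = b] (mod int d1)" and c2: "[c = b] (mod int d2)"
      using c(1) by (auto intro: cong_modulus_mult simp: mult.commute)
    have "\<eta>1 a = \<eta>1 c"
      using dirichlet_character_cong[OF eta1] c1 b1 cong_trans cong_sym by metis
    also have "\<dots> = \<eta>2 c" using eq c(2) by blast
    also have "\<dots> = \<eta>2 1"
      using dirichlet_character_cong[OF eta2] c2 b2 cong_trans by metis
    finally show ?thesis using dirichlet_character_one[OF eta2] by simp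
  qed
  from character_descends[OF eta1 pos(1) _ this] have
    "\<exists>\<eta>. dirichlet_character ?g \<eta> \<and> (\<forall>a. coprime a (int d1) \<longrightarrow> \<eta>1 a = \<eta> a)" by simp
  hence "\<not> ?g < d1" using prim by (auto simp: primitive_character_def)
  moreover have "?g \<le> d1" using pos by (simp add: gcd_le1_nat)
  ultimately show ?thesis by (metis gcd_dvd2 le_neq_implies_less)
qed

text \<open>Existence and uniqueness of the conductor. Primitive characters inducing the same
  character have moduli that divide each other, and agree because every unit class mod
  \<open>d1\<close> contains an integer coprime to \<open>q\<close>.\<close>

lemma bij_betw_induced_characters:
  assumes q: "q > 0"
  shows "bij_betw (\<lambda>(d, \<eta>). \<lambda>a. if coprime a (int q) then \<eta> a else 0)
           (SIGMA d:{d. d dvd q}. {\<eta>. primitive_character d \<eta>}) {\<psi>. dirichlet_character q \<psi>}"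
    (is "bij_betw ?f ?S _")
  unfolding bij_betw_def
proof
  have sub: "coprime a (int d)" if "coprime a (int q)" "d dvd q" for a d
    using that by (meson coprime_divisors dvd_refl of_nat_dvd_iff)
  show "inj_on ?f ?S"
  proof (rule inj_onI, clarify)
    fix d1 \<eta>1 d2 \<eta>2
    assume d: "d1 dvd q" "d2 dvd q" and prim: "primitive_character d1 \<eta>1" "primitive_character d2 \<eta>2"
      and eq: "(\<lambda>a. if coprime a (int q) then \<eta>1 a else 0) =
               (\<lambda>a. if coprime a (int q) then \<eta>2 a else 0)"
    have eq': "\<eta>1 a = \<eta>2 a" if "coprime a (int q)" for a
      using fun_cong[OF eq, of a] that by simp
    have dc: "dirichlet_character d1 \<eta>1" "dirichlet_character d2 \<eta>2"
      using prim by (auto simp: primitive_character_def)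
    have "d1 dvd d2" using primitive_modulus_dvd[OF prim(1) dc(2) d q eq'] by blast
    moreover have "d2 dvd d1"
      using primitive_modulus_dvd[OF prim(2) dc(1) d(2,1) q eq'[symmetric]] by blast
    ultimately have dd: "d1 = d2" by (simp add: dvd_antisym)
    have "\<eta>1 a = \<eta>2 a" for a
    proof (cases "coprime a (int d1)")
      case True
      then obtain b where b: "[b = a] (mod int d1)" "coprime b (int q)"
        using ex_cong_coprime q by blast
      have "\<eta>1 b = \<eta>1 a" using dirichlet_character_cong[OF dc(1) b(1)] .
      moreover have "\<eta>2 b = \<eta>2 a" using dirichlet_character_cong[OF dc(2)] b(1) dd by blast
      ultimately show ?thesis using eq'[OF b(2)] by simp
    next
      case False
      hence "\<eta>1 a = 0" "\<eta>2 a = 0"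
        using dirichlet_character_nz[OF dc(1), of a] dirichlet_character_nz[OF dc(2), of a] dd by auto
      thus ?thesis by simp
    qed
    with dd show "d1 = d2 \<and> \<eta>1 = \<eta>2" by auto
  qed
  show "?f ` ?S = {\<psi>. dirichlet_character q \<psi>}"
  proof (intro equalityI subsetI)
    fix \<psi> assume "\<psi> \<in> ?f ` ?S"
    then obtain d \<eta> where d: "d dvd q" and "primitive_character d \<eta>"
      and psi: "\<psi> = (\<lambda>a. if coprime a (int q) then \<eta> a else 0)" by auto
    hence eta: "dirichlet_character d \<eta>" by (simp add: primitive_character_def)
    have "[a + int q = a] (mod int d)" for a
      using d by (simp add: cong_iff_dvd_diff)
    hence "\<eta> (a + int q) = \<eta> a" for a using dirichlet_character_cong[OF eta] by blast
    thus "\<psi> \<in> {\<psi>. dirichlet_character q \<psi>}"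
      using dirichlet_character_mult[OF eta] dirichlet_character_nz[OF eta] sub[OF _ d]
      by (simp add: dirichlet_character_def psi coprime_add_modulus)
  next
    fix \<psi> assume "\<psi> \<in> {\<psi>. dirichlet_character q \<psi>}"
    hence psi: "dirichlet_character q \<psi>" by simp
    let ?P = "\<lambda>d. d dvd q \<and> (\<exists>\<eta>. dirichlet_character d \<eta> \<and> (\<forall>a. coprime a (int q) \<longrightarrow> \<psi> a = \<eta> a))"
    \<comment> \<open>The conductor of \<open>\<psi>\<close>; a smaller modulus inducing
      \<open>\<eta>\<close> would also induce \<open>\<psi>\<close>.\<close>
    define d where "d = (LEAST d. ?P d)"
    have "?P q" by (intro conjI exI[of _ \<psi>]) (use psi in auto)
    from LeastI[of ?P, OF this] have Pd: "?P d" by (simp only: d_def)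
    then obtain \<eta> where eta: "dirichlet_character d \<eta>" "\<And>a. coprime a (int q) \<Longrightarrow> \<psi> a = \<eta> a"
      by blast
    have "primitive_character d \<eta>"
      unfolding primitive_character_def
    proof (intro conjI notI; (elim exE conjE)?)
      fix d' \<eta>' assume *: "d' dvd d" "d' < d" "dirichlet_character d' \<eta>'"
        "\<forall>a. coprime a (int d) \<longrightarrow> \<eta> a = \<eta>' a"
      have "\<psi> a = \<eta>' a" if "coprime a (int q)" for a
        using that eta(2) sub[OF that, of d] Pd *(4) by simp
      moreover have "d' dvd q" using *(1) Pd dvd_trans[of d' d q] by simp
      ultimately have "?P d'" using *(3) by (intro conjI exI[of _ \<eta>']) simp_all
      moreover have "\<not> ?P d'" using *(2) unfolding d_def by (rule not_less_Least)
      ultimately show False by (rule notE[rotated])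
    qed (use eta in auto)
    moreover have "\<psi> = ?f (d, \<eta>)"
      using eta(2) dirichlet_character_nz[OF psi] by (auto simp: fun_eq_iff)
    ultimately show "\<psi> \<in> ?f ` ?S" using Pd by (intro image_eqI[of _ _ "(d, \<eta>)"]) simp_all
  qed
qed

text \<open>All later knowledge about \<open>num_primitive_characters\<close> is drawn from this
  identity.\<close>

theorem sum_num_primitive_characters:
  assumes q: "q > 0"
  shows "(\<Sum>d | d dvd q. num_primitive_characters d) = totient q"
proof -
  have "finite {\<eta>. primitive_character d \<eta>}" if "d dvd q" for d
    using finite_dirichlet_characters[of d] that q
    by (rule_tac finite_subset[of _ "{\<psi>. dirichlet_character d \<psi>}"])
      (auto simp: primitive_character_def intro: Nat.gr0I)
  moreover have "finite {d. d dvd q}" using q by simp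
  ultimately have "card (SIGMA d:{d. d dvd q}. {\<eta>. primitive_character d \<eta>}) =
      (\<Sum>d | d dvd q. num_primitive_characters d)"
    by (simp add: num_primitive_characters_def)
  thus ?thesis
    using bij_betw_same_card[OF bij_betw_induced_characters[OF q]] card_dirichlet_characters[OF q]
    by simp
qed

section \<open>The cusps of \<open>\<Gamma>\<^sub>0(M)\<close>\<close>

lemma card_quotient_kernel:
  "card (UNIV // {(x, y). f x = f y}) = card (range f)"
proof -
  have "{(x, y). f x = f y} `` {x} = f -` {f x}" for x by auto
  hence "UNIV // {(x, y). f x = f y} = (\<Union>x. {f -` {f x}})"
    by (simp only: quotient_def)
  also have "\<dots> = (\<lambda>y. f -` {y}) ` range f" by blast
  finally have "UNIV // {(x, y). f x = f y} = (\<lambda>y. f -` {y}) ` range f" .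
  moreover have "inj_on (\<lambda>y. f -` {y}) (range f)"
    by (rule inj_onI) blast
  ultimately have "bij_betw (\<lambda>y. f -` {y}) (range f) (UNIV // {(x, y). f x = f y})"
    by (simp add: bij_betw_def)
  from bij_betw_same_card[OF this] show ?thesis ..
qed

text \<open>Homogeneous coordinates: the action becomes linear and infinity needs no separate
  treatment. Coprime coordinates are determined up to a common sign.\<close>

definition proj_point :: "int \<Rightarrow> int \<Rightarrow> rat option" where
  "proj_point u v = (if v = 0 then None else Some (of_int u / of_int v))"

lemma proj_point_cases:
  obtains u v where "c = proj_point u v" "coprime u v"
proof (cases c)
  case None
  thus ?thesis using that[of 1 0] by (simp add: proj_point_def)
next
  case (Some x)
  obtain u v where uv: "quotient_of x = (u, v)" by (cases "quotient_of x")
  show ?thesis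
    using that[of u v] Some quotient_of_div[OF uv] quotient_of_coprime[OF uv]
      quotient_of_denom_pos[OF uv] by (simp add: proj_point_def)
qed

lemma proj_point_eq:
  assumes "proj_point u v = proj_point u' v'" "coprime u v" "coprime u' v'"
  shows "u' = u \<and> v' = v \<or> u' = - u \<and> v' = - v"
proof (cases "v = 0")
  case True
  hence "v' = 0" using assms(1) by (simp add: proj_point_def split: if_splits)
  thus ?thesis using True assms by auto
next
  case False
  hence v': "v' \<noteq> 0" using assms(1) by (simp add: proj_point_def split: if_splits)
  have "(of_int u :: rat) / of_int v = of_int u' / of_int v'"
    using assms(1) False v' by (simp add: proj_point_def)
  hence "of_int (u * v') = (of_int (u' * v) :: rat)"
    using False v' by (simp add: field_simps)
  hence eq: "u * v' = u' * v" using of_int_eq_iff by blast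
  hence "v dvd v'" using assms(2) by (metis coprime_commute coprime_dvd_mult_right_iff dvd_triv_right)
  moreover have "v' dvd v"
    using eq assms(3) by (metis coprime_commute coprime_dvd_mult_right_iff dvd_triv_right)
  ultimately have "\<bar>v'\<bar> = \<bar>v\<bar>" by (intro zdvd_antisym_abs)
  hence "v' = v \<or> v' = - v" by linarith
  thus ?thesis
  proof
    assume "v' = v"
    thus ?thesis using eq False by simp
  next
    assume v: "v' = - v"
    hence "(u + u') * v = 0" using eq by (simp add: distrib_right)
    hence "u' = - u" using False by simp
    with v show ?thesis by simp
  qed
qed

lemma moebius_proj_point:
  assumes "det A = 1" "coprime u v"
  shows "moebius A (proj_point u v) =
           proj_point (A $ 1 $ 1 * u + A $ 1 $ 2 * v) (A $ 2 $ 1 * u + A $ 2 $ 2 * v)"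
proof (cases "v = 0")
  case True
  hence "u \<noteq> 0" using assms(2) by auto
  thus ?thesis using True by (simp add: proj_point_def)
next
  case False
  have *: "(of_int c * (of_int u / of_int v) + of_int d :: rat) = of_int (c * u + d * v) / of_int v"
    for c d using False by (simp add: field_simps)
  show ?thesis
    using False
    by (simp only: proj_point_def moebius.simps * if_False divide_eq_0_iff of_int_eq_0_iff)
      (simp add: False)
qed

definition cusp_gcd :: "nat \<Rightarrow> int \<Rightarrow> nat" where
  "cusp_gcd M v = gcd (nat \<bar>v\<bar>) M"

definition cusp_width_gcd :: "nat \<Rightarrow> nat \<Rightarrow> nat" where
  "cusp_width_gcd M m = gcd m (M div m)"

text \<open>A complete invariant of the cusp \<open>u / v\<close> for coprime \<open>u\<close> and
  \<open>v\<close>: next to the gcd of \<open>v\<close> with \<open>M\<close>, it keeps of the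
  numerator the class of \<open>u * (v / m)\<close> mod \<open>gcd m (M / m)\<close>.\<close>

definition cusp_inv :: "nat \<Rightarrow> int \<Rightarrow> int \<Rightarrow> nat \<times> int" where
  "cusp_inv M u v = (let m = cusp_gcd M v in
     (m, (u * (v div int m)) mod int (cusp_width_gcd M m)))"

lemma int_cusp_gcd: "int (cusp_gcd M v) = gcd v (int M)"
  by (simp add: cusp_gcd_def flip: gcd_int_int_eq)

lemma cusp_inv_uminus: "cusp_inv M (- u) (- v) = cusp_inv M u v"
proof -
  have "int (cusp_gcd M v) dvd v" by (simp add: int_cusp_gcd)
  hence "- u * (- v div int (cusp_gcd M v)) = u * (v div int (cusp_gcd M v))"
    by (simp add: dvd_neg_div)
  moreover have "cusp_gcd M (- v) = cusp_gcd M v" by (simp add: cusp_gcd_def)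
  ultimately show ?thesis by (simp add: cusp_inv_def Let_def)
qed

lemma cusp_decomp:
  assumes "M > 0"
  obtains m w N where "m = cusp_gcd M v" "m > 0" "v = int m * w" "M = m * N" "coprime w (int N)"
    "cusp_width_gcd M m = gcd m N" "v div int m = w"
proof -
  define m where "m = cusp_gcd M v"
  have pos: "m > 0" using assms by (simp add: m_def cusp_gcd_def)
  have "m dvd M" unfolding m_def cusp_gcd_def by (rule gcd_dvd2)
  then obtain N where N: "M = m * N" by blast
  have im: "int m = gcd v (int M)" by (simp add: m_def int_cusp_gcd)
  hence "int m dvd v" by simp
  then obtain w where w: "v = int m * w" by blast
  have "int m * gcd w (int N) = gcd (int m * w) (int m * int N)"
    by (metis abs_of_nat gcd_mult_distrib_int)
  also have "\<dots> = gcd v (int M)" by (simp only: w N of_nat_mult)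
  also have "\<dots> = int m" by (rule im[symmetric])
  finally have "coprime w (int N)" using pos by (simp add: coprime_iff_gcd_eq_1)
  moreover have "cusp_width_gcd M m = gcd m N"
    using pos by (simp add: cusp_width_gcd_def N)
  moreover have "v div int m = w" using pos by (simp add: w)
  ultimately show ?thesis using that[OF m_def pos w N] by blast
qed

text \<open>Since \<open>M\<close> divides \<open>c\<close>, the entry \<open>d\<close> is a unit
  mod \<open>M\<close>, so the gcd with \<open>M\<close> is preserved. Modulo \<open>gcd m N\<close>
  both \<open>m\<close> and \<open>N\<close> vanish, which reduces the second component to
  \<open>a * d * u * w\<close> with \<open>a * d\<close> congruent to 1.\<close>

lemma cusp_inv_Gamma0:
  assumes M: "M > 0" and det: "a * d - b * c = 1" and c: "int M dvd c"
  shows "cusp_inv M (a * u + b * v) (c * u + d * v) = cusp_inv M u v"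
proof -
  obtain m w N where m: "m = cusp_gcd M v" "m > 0" and w: "v = int m * w" and N: "M = m * N"
    and wid: "cusp_width_gcd M m = gcd m N" and div: "v div int m = w"
    using cusp_decomp[OF M, of v] by metis
  obtain k where k: "c = int M * k" using c by blast
  have "coprime d (int M)"
  proof (rule coprimeI)
    fix x assume "x dvd d" "x dvd int M"
    hence "x dvd a * d - b * c" using dvd_trans[OF _ c] by (intro dvd_diff dvd_mult) auto
    thus "is_unit x" using det by simp
  qed
  hence "gcd (d * v) (int M) = gcd v (int M)" 
    by (intro gcd_mult_left_left_cancel) (simp add: coprime_commute)
  moreover have "[c * u + d * v = d * v] (mod int M)" by (simp add: k cong_iff_dvd_diff)
  hence "gcd (c * u + d * v) (int M) = gcd (d * v) (int M)" by (rule cong_gcd_eq)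
  ultimately have "int (cusp_gcd M (c * u + d * v)) = int m" by (simp add: m(1) int_cusp_gcd)
  hence g: "cusp_gcd M (c * u + d * v) = m" by simp
  have "c * u + d * v = int m * (int N * k * u + d * w)"
    by (simp add: k N w algebra_simps)
  hence div': "(c * u + d * v) div int m = int N * k * u + d * w" using m by simp
  let ?g = "int (gcd m N)"
  have gN: "[int N = 0] (mod ?g)" and gm: "[int m = 0] (mod ?g)"
    by (simp_all add: cong_0_iff)
  have "[(a * u + b * (int m * w)) * (int N * k * u + d * w) = (a * u + b * (0 * w)) * (0 * k * u + d * w)] (mod ?g)"
    using gN gm by (intro cong_mult cong_add cong_refl)
  also have "(a * u + b * (0 * w)) * (0 * k * u + d * w) = u * w * (a * d)" by simp
  also have "a * d = 1 + b * k * int N * int m" using det by (simp add: k N algebra_simps)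
  also have "[u * w * (1 + b * k * int N * int m) = u * w * (1 + b * k * int N * 0)] (mod ?g)"
    using gm by (intro cong_mult cong_add cong_refl)
  finally have "[(a * u + b * v) * (int N * k * u + d * w) = u * w] (mod ?g)" by (simp add: w)
  thus ?thesis using g div div' wid by (simp add: cusp_inv_def cong_def m(1)[symmetric])
qed

lemma coprime_bezout_int:
  assumes "coprime u (v :: int)"
  obtains x y where "u * y - x * v = 1"
proof -
  obtain s t where "s * u + t * v = gcd u v" using bezout_int[of u v] by blast
  hence "u * s - (- t) * v = 1" using assms by (simp add: mult.commute)
  thus ?thesis by (rule that)
qed

text \<open>Extending the two coordinate pairs to matrices of determinant 1 leaves one free integer
  \<open>k\<close> in the matrix sought. Its lower left entry is divisible by \<open>M\<close> iff
  \<open>m * w * w' * k\<close> is congruent to \<open>w' * y - w * y'\<close> mod \<open>N\<close>.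
  As \<open>w\<close> and \<open>w'\<close> are coprime to \<open>N\<close>, this is solvable iff
  \<open>gcd m N\<close> divides the right side, which follows from the equality of the second
  invariants.\<close>

lemma cusp_inv_complete:
  assumes M: "M > 0" and co: "coprime u v" "coprime u' v'"
    and eq: "cusp_inv M u v = cusp_inv M u' v'"
  obtains a b c d where "a * d - b * c = 1" "int M dvd c"
    "a * u + b * v = u'" "c * u + d * v = v'"
proof -
  obtain m w N where m: "m = cusp_gcd M v" "m > 0" and w: "v = int m * w" and N: "M = m * N"
    and cw: "coprime w (int N)" and wid: "cusp_width_gcd M m = gcd m N" and div: "v div int m = w"
    using cusp_decomp[OF M, of v] by metis
  have m': "m = cusp_gcd M v'" using eq m(1) by (simp add: cusp_inv_def Let_def)
  obtain w' N' where w': "v' = int m * w'" and N': "M = m * N'"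
    and cw': "coprime w' (int N')" and div': "v' div int m = w'"
    using cusp_decomp[OF M, of v'] m' by metis
  have [simp]: "N' = N" using N N' m(2) by simp
  let ?g = "int (gcd m N)"
  have gm: "?g dvd int m" by simp
  have uw: "[u * w = u' * w'] (mod ?g)"
    using eq wid by (simp add: cusp_inv_def Let_def cong_def m(1)[symmetric] m'[symmetric] div div')
  obtain x y where xy: "u * y - x * v = 1" using coprime_bezout_int[OF co(1)] .
  obtain x' y' where xy': "u' * y' - x' * v' = 1" using coprime_bezout_int[OF co(2)] .
  have uy: "[u * y = 1] (mod ?g)" and uy': "[u' * y' = 1] (mod ?g)"
  proof -
    have "u * y - 1 = int m * (x * w)" "u' * y' - 1 = int m * (x' * w')"
      using xy xy' by (simp_all add: w w' algebra_simps)
    thus "[u * y = 1] (mod ?g)" "[u' * y' = 1] (mod ?g)"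
      using gm by (simp_all add: cong_iff_dvd_diff)
  qed
  \<comment> \<open>Because \<open>y\<close> and \<open>y'\<close> invert \<open>u\<close> and
    \<open>u'\<close> modulo \<open>?g\<close>, multiplying by \<open>u * u'\<close> turns this
    expression into the difference of the two invariants; the factor is a unit and is cancelled
    afterwards.\<close>
  have "[(u * u') * (w' * y - w * y') = (u' * w') * (u * y) - (u * w) * (u' * y')] (mod ?g)"
    by (simp add: algebra_simps)
  also have "[(u' * w') * (u * y) - (u * w) * (u' * y') = (u' * w') * 1 - (u' * w') * 1] (mod ?g)"
    by (rule cong_diff[OF cong_mult[OF cong_refl uy] cong_mult[OF uw uy']])
  finally have dvd: "?g dvd (u * u') * (w' * y - w * y')" by (simp only: cong_0_iff diff_self)
  have "coprime u ?g" "coprime u' ?g"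
    using uy uy' coprime_iff_invertible_int by blast+
  hence "coprime (u * u') ?g" by (simp only: coprime_mult_left_iff)
  hence "coprime ?g (u * u')" by (simp only: coprime_commute)
  from iffD1[OF coprime_dvd_mult_right_iff[OF this] dvd] have "?g dvd w' * y - w * y'" .
  moreover have "gcd (int m * w * w') (int N) = ?g"
  proof -
    have "gcd (int m * (w * w')) (int N) = gcd (int m) (int N)"
      using cw cw' by (intro gcd_mult_left_right_cancel) (simp add: coprime_commute)
    thus ?thesis by (simp add: mult.assoc)
  qed
  ultimately obtain k where "[int m * w * w' * k = w' * y - w * y'] (mod int N)"
    using cong_solve_dvd_int[of "int m * w * w'" "int N" "w' * y - w * y'"] by metis
  from cong_sym[OF this] have "int N dvd w' * y - w * y' - int m * w * w' * k"
    by (simp only: cong_iff_dvd_diff)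
  then obtain l where l: "w' * y - w * y' - int m * w * w' * k = int N * l" ..
  \<comment> \<open>The matrix is \<open>\<gamma>' T\<^sup>k \<gamma>\<inverse>\<close>, where \<open>\<gamma>\<close> and \<open>\<gamma>'\<close> have first columns \<open>(u, v)\<close> and \<open>(u', v')\<close>.\<close>
  let ?X = "k * u' + x'" and ?Y = "k * v' + y'"
  show ?thesis
  proof (rule that[of "u' * y - ?X * v" "?Y * u - v' * x" "?X * u - u' * x" "v' * y - ?Y * v"])
    have "(u' * y - ?X * v) * (?Y * u - v' * x) - (?X * u - u' * x) * (v' * y - ?Y * v) =
        (u' * y' - x' * v') * (u * y - x * v)" by (simp add: algebra_simps)
    thus "(u' * y - ?X * v) * (?Y * u - v' * x) - (?X * u - u' * x) * (v' * y - ?Y * v) = 1"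
      by (simp add: xy xy')
    have "v' * y - ?Y * v = int m * (w' * y - w * y' - int m * w * w' * k)"
      by (simp add: w w' algebra_simps)
    also have "\<dots> = int M * l" by (simp add: l N)
    finally show "int M dvd v' * y - ?Y * v" by simp
    have "(u' * y - ?X * v) * u + (?X * u - u' * x) * v = u' * (u * y - x * v)" by (simp add: algebra_simps)
    thus "(u' * y - ?X * v) * u + (?X * u - u' * x) * v = u'" by (simp add: xy)
    have "(v' * y - ?Y * v) * u + (?Y * u - v' * x) * v = v' * (u * y - x * v)" by (simp add: algebra_simps)
    thus "(v' * y - ?Y * v) * u + (?Y * u - v' * x) * v = v'" by (simp add: xy)
  qed
qed

lemma cusp_inv_mem:
  assumes M: "M > 0" and co: "coprime u v"
  shows "cusp_inv M u v \<in> (SIGMA m:{m. m dvd M}.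
           {r. coprime r (int (cusp_width_gcd M m))} \<inter> {0..<int (cusp_width_gcd M m)})"
proof -
  obtain m w N where m: "m = cusp_gcd M v" "m > 0" and w: "v = int m * w" and N: "M = m * N"
    and cw: "coprime w (int N)" and wid: "cusp_width_gcd M m = gcd m N" and div: "v div int m = w"
    using cusp_decomp[OF M, of v] by metis
  let ?g = "gcd m N"
  have inv: "cusp_inv M u v = (m, (u * w) mod int ?g)"
    by (simp add: cusp_inv_def Let_def m(1)[symmetric] div wid)
  have "int ?g dvd int m" "int ?g dvd int N" unfolding int_dvd_int_iff by simp_all
  hence "int ?g dvd v" "int ?g dvd int N" by (simp_all only: w dvd_mult2)
  hence "coprime u (int ?g)" "coprime w (int ?g)"
    using co cw coprime_divisors[OF dvd_refl] by blast+
  hence "coprime (u * w) (int ?g)" by (simp only: coprime_mult_left_iff)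
  moreover have "?g > 0" using m by simp
  ultimately show ?thesis
    unfolding inv using wid N by simp
qed

text \<open>With denominator \<open>m\<close> itself the second component is just the numerator's
  residue, and the numerator may be shifted by multiples of the modulus until it is coprime to
  \<open>m\<close>.\<close>

lemma cusp_inv_surj:
  assumes M: "M > 0" and m: "m dvd M" and r: "coprime r (int (cusp_width_gcd M m))"
    "0 \<le> r" "r < int (cusp_width_gcd M m)"
  obtains u where "coprime u (int m)" "cusp_inv M u (int m) = (m, r)"
proof -
  have m0: "m > 0" using M m by (auto intro: Nat.gr0I)
  obtain k where k: "coprime (r + int (cusp_width_gcd M m) * k) (int m)"
    using ex_coprime_shift[OF r(1), of "int m"] m0 by auto
  moreover have "cusp_gcd M (int m) = m" using m by (simp add: cusp_gcd_def gcd_nat.absorb1)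
  hence "cusp_inv M (r + int (cusp_width_gcd M m) * k) (int m) = (m, r)"
    using m0 r by (simp add: cusp_inv_def Let_def)
  ultimately show ?thesis by (rule that)
qed

text \<open>Equivalence of cusps is the kernel relation of the invariant, so the classes are counted
  by its range: for each divisor \<open>m\<close>, the units modulo
  \<open>gcd m (M div m)\<close>.\<close>

lemma num_cusps_eq:
  assumes M: "M > 0"
  shows "num_cusps M = (\<Sum>m | m dvd M. totient (gcd m (M div m)))"
proof -
  \<comment> \<open>The choice is harmless: coprime coordinates of a point differ only by sign, and
    \<open>cusp_inv_uminus\<close> shows that the invariant ignores it.\<close>
  define f where
    "f c = (SOME i. \<exists>u v. c = proj_point u v \<and> coprime u v \<and> i = cusp_inv M u v)" for c
  have f: "f (proj_point u v) = cusp_inv M u v" if "coprime u v" for u v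
  proof -
    have "\<exists>u' v'. proj_point u v = proj_point u' v' \<and> coprime u' v' \<and>
            f (proj_point u v) = cusp_inv M u' v'"
      unfolding f_def by (rule someI_ex) (use that in blast)
    then obtain u' v' where "proj_point u v = proj_point u' v'" "coprime u' v'"
      and *: "f (proj_point u v) = cusp_inv M u' v'" by blast
    from proj_point_eq[OF this(1) that this(2)] show ?thesis
      unfolding * by (elim disjE) (simp_all add: cusp_inv_uminus)
  qed
  have "cusp_equiv M = {(x, y). f x = f y}"
  proof (intro equalityI subsetI)
    fix p assume "p \<in> cusp_equiv M"
    then obtain x y A where p: "p = (x, y)" and A: "A \<in> Gamma0 M" and y: "y = moebius A x"
      by (auto simp: cusp_equiv_def)
    obtain u v where x: "x = proj_point u v" and co: "coprime u v" by (rule proj_point_cases)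
    have det: "det A = 1" and c: "int M dvd A $ 2 $ 1" using A by (auto simp: Gamma0_def)
    let ?u = "A $ 1 $ 1 * u + A $ 1 $ 2 * v" and ?v = "A $ 2 $ 1 * u + A $ 2 $ 2 * v"
    have det': "A $ 1 $ 1 * A $ 2 $ 2 - A $ 1 $ 2 * A $ 2 $ 1 = 1"
      using det by (simp add: det_2)
    have "coprime ?u ?v"
    proof (rule coprimeI)
      fix e assume e: "e dvd ?u" "e dvd ?v"
      have "A $ 2 $ 2 * ?u - A $ 1 $ 2 * ?v = (A $ 1 $ 1 * A $ 2 $ 2 - A $ 1 $ 2 * A $ 2 $ 1) * u"
        by (simp add: algebra_simps)
      hence "e dvd u" using dvd_diff[OF dvd_mult[OF e(1)] dvd_mult[OF e(2)]] det'
        by (metis mult_1)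
      moreover have "A $ 1 $ 1 * ?v - A $ 2 $ 1 * ?u =
          (A $ 1 $ 1 * A $ 2 $ 2 - A $ 1 $ 2 * A $ 2 $ 1) * v"
        by (simp add: algebra_simps)
      hence "e dvd v" using dvd_diff[OF dvd_mult[OF e(2)] dvd_mult[OF e(1)]] det'
        by (metis mult_1)
      ultimately show "is_unit e" using co coprime_common_divisor by blast
    qed
    moreover have "y = proj_point ?u ?v"
      unfolding y x using moebius_proj_point[OF det co] .
    ultimately have "f y = cusp_inv M ?u ?v" using f by simp
    also have "\<dots> = cusp_inv M u v" using cusp_inv_Gamma0[OF M det' c] .
    also have "\<dots> = f x" using f[OF co] x by simp
    finally show "p \<in> {(x, y). f x = f y}" using p by simp
  next
    fix p assume "p \<in> {(x, y). f x = f y}"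
    then obtain x y where p: "p = (x, y)" and eq: "f x = f y" by auto
    obtain u v where x: "x = proj_point u v" and co: "coprime u v" by (rule proj_point_cases)
    obtain u' v' where y: "y = proj_point u' v'" and co': "coprime u' v'" by (rule proj_point_cases)
    have "cusp_inv M u v = cusp_inv M u' v'" using eq f[OF co] f[OF co'] x y by simp
    from cusp_inv_complete[OF M co co' this] obtain a b c d
      where *: "a * d - b * c = 1" "int M dvd c" "a * u + b * v = u'" "c * u + d * v = v'" .
    define A :: "int ^ 2 ^ 2" where "A = vector [vector [a, b], vector [c, d]]"
    have det: "det A = 1" using * by (simp add: A_def det_2)
    hence "A \<in> Gamma0 M" using * by (simp add: Gamma0_def A_def)
    moreover have "y = moebius A x"
      unfolding x moebius_proj_point[OF det co] y using * by (simp add: A_def)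
    ultimately show "p \<in> cusp_equiv M" using p by (auto simp: cusp_equiv_def)
  qed
  hence "num_cusps M = card (range f)"
    by (simp add: num_cusps_def card_quotient_kernel)
  also have "range f = (SIGMA m:{m. m dvd M}.
      {r. coprime r (int (cusp_width_gcd M m))} \<inter> {0..<int (cusp_width_gcd M m)})" (is "_ = ?S")
  proof (intro equalityI subsetI)
    fix i assume "i \<in> range f"
    then obtain c where i: "i = f c" by blast
    obtain u v where "c = proj_point u v" "coprime u v" by (rule proj_point_cases)
    thus "i \<in> ?S" using i f cusp_inv_mem[OF M] by simp
  next
    fix i assume "i \<in> ?S"
    then obtain m r where i: "i = (m, r)" "m dvd M" "coprime r (int (cusp_width_gcd M m))"
      "0 \<le> r" "r < int (cusp_width_gcd M m)" by auto
    obtain u where u: "coprime u (int m)" "cusp_inv M u (int m) = (m, r)"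
      using cusp_inv_surj[OF M i(2-5)] .
    have "f (proj_point u (int m)) = i" using f[OF u(1)] u(2) i(1) by simp
    thus "i \<in> range f" by blast
  qed
  also have "card ?S = (\<Sum>m | m dvd M. totient (cusp_width_gcd M m))"
    using M by (subst card_SigmaI) (auto simp: card_coprime_residues)
  finally show ?thesis by (simp add: cusp_width_gcd_def)
qed

section \<open>Multiplicative functions\<close>

definition multiplicative :: "(nat \<Rightarrow> real) \<Rightarrow> bool" where
  "multiplicative f \<longleftrightarrow> f 1 = 1 \<and> (\<forall>a b. a > 0 \<longrightarrow> b > 0 \<longrightarrow> coprime a b \<longrightarrow> f (a * b) = f a * f b)"

lemma multiplicativeD:
  "multiplicative f \<Longrightarrow> f 1 = 1"
  "multiplicative f \<Longrightarrow> a > 0 \<Longrightarrow> b > 0 \<Longrightarrow> coprime a b \<Longrightarrow> f (a * b) = f a * f b"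
  unfolding multiplicative_def by blast+

lemma sum_divisors_coprime:
  fixes f :: "nat \<Rightarrow> real"
  assumes "coprime a b" "a > 0" "b > 0"
  shows "(\<Sum>d | d dvd a * b. f d) = (\<Sum>x | x dvd a. \<Sum>y | y dvd b. f (x * y))"
proof -
  have "bij_betw (\<lambda>(x, y). x * y) ({x. x dvd a} \<times> {y. y dvd b}) {d. d dvd a * b}"
    unfolding bij_betw_def
  proof
    show "inj_on (\<lambda>(x, y). x * y) ({x. x dvd a} \<times> {y. y dvd b})"
    proof (rule inj_onI, clarify)
      fix x y x' y' assume *: "x dvd a" "y dvd b" "x' dvd a" "y' dvd b" "x * y = x' * y'"
      have "coprime x y'" "coprime x' y"
        using * assms(1) coprime_divisors by blast+
      hence "x dvd x'" "x' dvd x"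
        using *(5) by (metis coprime_dvd_mult_left_iff dvd_triv_left)+
      hence "x = x'" by (rule dvd_antisym)
      moreover have "x > 0" using *(1) assms(2) by (auto intro: Nat.gr0I)
      ultimately show "x = x' \<and> y = y'" using *(5) by simp
    qed
    show "(\<lambda>(x, y). x * y) ` ({x. x dvd a} \<times> {y. y dvd b}) = {d. d dvd a * b}"
    proof (intro equalityI subsetI)
      fix d assume "d \<in> {d. d dvd a * b}"
      then obtain x y where "d = x * y" "x dvd a" "y dvd b" using division_decomp by blast
      thus "d \<in> (\<lambda>(x, y). x * y) ` ({x. x dvd a} \<times> {y. y dvd b})" by force
    qed (auto intro: mult_dvd_mono)
  qed
  from sum.reindex_bij_betw[OF this, of f] show ?thesis
    by (simp add: sum.cartesian_product case_prod_unfold)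
qed

lemma divisors_coprime_facts:
  fixes a b x y :: nat
  assumes "coprime a b" "a > 0" "b > 0" "x dvd a" "y dvd b"
  shows "x > 0" "y > 0" "a div x > 0" "b div y > 0" "coprime x y" "coprime (a div x) (b div y)"
    "(a * b) div (x * y) = (a div x) * (b div y)"
proof -
  obtain x' y' where xy: "a = x * x'" "b = y * y'" using assms(4,5) by blast
  show "x > 0" "y > 0" using xy assms(2,3) by auto
  thus "a div x > 0" "b div y > 0" "coprime x y" "coprime (a div x) (b div y)"
    "(a * b) div (x * y) = (a div x) * (b div y)"
    using xy assms(1-3) by (auto simp: div_mult_div_if_dvd)
qed

lemma multiplicative_dirichlet_conv:
  assumes f: "multiplicative f" and g: "multiplicative g"
  shows "multiplicative (dirichlet_conv f g)"
  unfolding multiplicative_def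
proof (intro conjI allI impI)
  show "dirichlet_conv f g 1 = 1"
    using multiplicativeD(1)[OF f] multiplicativeD(1)[OF g] by (simp add: dirichlet_conv_def)
next
  fix a b :: nat assume ab: "a > 0" "b > 0" "coprime a b"
  have "dirichlet_conv f g (a * b) =
      (\<Sum>x | x dvd a. \<Sum>y | y dvd b. f (x * y) * g ((a * b) div (x * y)))"
    unfolding dirichlet_conv_def by (rule sum_divisors_coprime) (use ab in auto)
  also have "\<dots> = (\<Sum>x | x dvd a. \<Sum>y | y dvd b. (f x * g (a div x)) * (f y * g (b div y)))"
  proof (intro sum.cong refl)
    fix x y assume "x \<in> {x. x dvd a}" "y \<in> {y. y dvd b}"
    hence "x dvd a" "y dvd b" by auto
    note * = divisors_coprime_facts[OF ab(3,1,2) this]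
    show "f (x * y) * g ((a * b) div (x * y)) = (f x * g (a div x)) * (f y * g (b div y))"
      using multiplicativeD(2)[OF f *(1,2,5)] multiplicativeD(2)[OF g *(3,4,6)] *(7) by simp
  qed
  also have "\<dots> = dirichlet_conv f g a * dirichlet_conv f g b"
    by (simp add: dirichlet_conv_def sum_product)
  finally show "dirichlet_conv f g (a * b) = dirichlet_conv f g a * dirichlet_conv f g b" .
qed

text \<open>Induction on the product \<open>a * b\<close>: in the double sum over divisors of
  \<open>a\<close> and of \<open>b\<close>, all terms except the top one agree by the induction
  hypothesis, so the top one agrees too.\<close>

lemma multiplicative_sum_divisors_imp:
  assumes h: "multiplicative (\<lambda>n. \<Sum>d | d dvd n. f d)"
  shows "multiplicative f"
  unfolding multiplicative_def
proof (intro conjI allI impI)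
  show "f 1 = 1" using multiplicativeD(1)[OF h] by simp
  fix a b :: nat assume ab: "a > 0" "b > 0" "coprime a b"
  have "f (a * b) = f a * f b" if "n = a * b" "a > 0" "b > 0" "coprime a b" for n a b
    using that
  proof (induction n arbitrary: a b rule: less_induct)
    case (less n a b)
    have IH: "f (x * y) = f x * f y" if "x dvd a" "y dvd b" "(x, y) \<noteq> (a, b)" for x y
    proof (rule less.IH[OF _ refl])
      note * = divisors_coprime_facts[OF less.prems(4,2,3) that(1,2)]
      show "x > 0" "y > 0" "coprime x y" using * by auto
      have "x \<le> a" "y \<le> b" using that(1,2) less.prems dvd_imp_le by blast+
      moreover have "x < a \<or> y < b" using that(3) calculation by auto
      ultimately show "x * y < n"
        using less.prems * by (auto intro: mult_less_le_imp_less mult_le_less_imp_less)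
    qed
    let ?S = "{x. x dvd a} \<times> {y. y dvd b}"
    have fin: "finite ?S" using less.prems by simp
    have "(\<Sum>(x, y)\<in>?S. f (x * y)) = (\<Sum>d | d dvd a * b. f d)"
      using sum_divisors_coprime[of a b f] less.prems by (simp add: sum.cartesian_product)
    also have "\<dots> = (\<Sum>d | d dvd a. f d) * (\<Sum>d | d dvd b. f d)"
      using multiplicativeD(2)[OF h less.prems(2-4)] .
    also have "\<dots> = (\<Sum>(x, y)\<in>?S. f x * f y)"
      by (simp add: sum_product sum.cartesian_product)
    finally have eq: "(\<Sum>(x, y)\<in>?S. f (x * y)) = (\<Sum>(x, y)\<in>?S. f x * f y)" .
    have "(\<Sum>(x, y)\<in>?S - {(a, b)}. f (x * y)) = (\<Sum>(x, y)\<in>?S - {(a, b)}. f x * f y)"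
      by (intro sum.cong refl) (use IH in auto)
    with eq show ?case
      using fin by (simp add: sum.remove[of ?S "(a, b)"])
  qed
  with ab show "f (a * b) = f a * f b" by blast
qed

lemma multiplicative_prod_primes:
  assumes f: "multiplicative f" and "finite S" "\<And>p. p \<in> S \<Longrightarrow> prime p"
  shows "f (\<Prod>p\<in>S. p ^ e p) = (\<Prod>p\<in>S. f (p ^ e p))"
  using assms(2,3)
proof (induction S rule: finite_induct)
  case empty
  show ?case using multiplicativeD(1)[OF f] by simp
next
  case (insert p S)
  have pos: "q ^ e q > 0" if "q \<in> insert p S" for q
    using insert.prems[OF that] prime_gt_0_nat by simp
  have "coprime (p ^ e p) (\<Prod>q\<in>S. q ^ e q)"
    using insert.hyps insert.prems
    by (intro prod_coprime_right coprime_power_left_iff[THEN iffD2] coprime_power_right_iff[THEN iffD2] disjI1 primes_coprime) auto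
  moreover have "(\<Prod>q\<in>S. q ^ e q) > 0" using pos by (intro prod_pos) auto
  ultimately show ?case
    using insert multiplicativeD(2)[OF f, of "p ^ e p" "\<Prod>q\<in>S. q ^ e q"] pos by simp
qed

lemma multiplicative_prime_factors:
  assumes "multiplicative f" "n > 0"
  shows "f n = (\<Prod>p\<in>prime_factors n. f (p ^ multiplicity p n))"
proof -
  have "n = (\<Prod>p\<in>prime_factors n. p ^ multiplicity p n)"
    using assms(2) by (rule prime_factorization_nat)
  hence "f n = f (\<Prod>p\<in>prime_factors n. p ^ multiplicity p n)" by simp
  also have "\<dots> = (\<Prod>p\<in>prime_factors n. f (p ^ multiplicity p n))"
    by (rule multiplicative_prod_primes[OF assms(1)]) auto
  finally show ?thesis .
qed

lemma sum_divisors_prime_power: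
  fixes f :: "nat \<Rightarrow> real"
  assumes "prime p"
  shows "(\<Sum>d | d dvd p ^ e. f d) = (\<Sum>i\<le>e. f (p ^ i))"
proof -
  have "{d. d dvd p ^ e} = (\<lambda>i. p ^ i) ` {..e}"
    using divides_primepow_nat[OF assms] by auto
  moreover have "inj_on (\<lambda>i. p ^ i) {..e}"
    using prime_gt_1_nat[OF assms] by (auto simp: inj_on_def)
  ultimately show ?thesis by (simp add: sum.reindex)
qed

text \<open>The convolution square of the Moebius function, as \<open>sigma0\<close> is the square
  of the constant 1. At a prime it has the generating polynomial (1 - X)^2, hence 1, -2, 1.\<close>

definition sigma0_inv :: "nat \<Rightarrow> real" where
  "sigma0_inv n = (if n = 0 then 0 else \<Prod>p\<in>prime_factors n.
     (let e = multiplicity p n in if e = 1 then -2 else if e = 2 then 1 else 0))"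

lemma sigma0_inv_prime_power:
  assumes "prime p"
  shows "sigma0_inv (p ^ e) = (if e = 0 then 1 else if e = 1 then -2 else if e = 2 then 1 else 0)"
proof (cases "e = 0")
  case False
  hence "prime_factors (p ^ e) = {p}" using assms by (simp add: prime_factors_power prime_prime_factors)
  moreover have "multiplicity p (p ^ e) = e" using assms by simp
  moreover have "p \<noteq> 0" using assms by auto
  ultimately show ?thesis using False by (simp add: sigma0_inv_def Let_def)
qed (simp add: sigma0_inv_def)

lemma multiplicative_sigma0_inv: "multiplicative sigma0_inv"
  unfolding multiplicative_def
proof (intro conjI allI impI)
  fix a b :: nat assume ab: "a > 0" "b > 0" "coprime a b"
  have un: "prime_factors (a * b) = prime_factors a \<union> prime_factors b"
    using ab by (simp add: prime_factors_product)
  have disj: "prime_factors a \<inter> prime_factors b = {}"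
  proof (rule ccontr)
    assume "prime_factors a \<inter> prime_factors b \<noteq> {}"
    then obtain p where "prime p" "p dvd a" "p dvd b" by (auto simp: in_prime_factors_iff)
    thus False using ab(3) coprime_common_divisor not_prime_unit by blast
  qed
  have ma: "multiplicity p (a * b) = multiplicity p a" if "p \<in> prime_factors a" for p
  proof -
    have "\<not> p dvd b" using that disj ab by (auto simp: in_prime_factors_iff)
    thus ?thesis using that ab
      by (simp add: in_prime_factors_iff prime_elem_multiplicity_mult_distrib not_dvd_imp_multiplicity_0)
  qed
  have mb: "multiplicity p (a * b) = multiplicity p b" if "p \<in> prime_factors b" for p
  proof -
    have "\<not> p dvd a" using that disj ab by (auto simp: in_prime_factors_iff)
    thus ?thesis using that ab
      by (simp add: in_prime_factors_iff prime_elem_multiplicity_mult_distrib not_dvd_imp_multiplicity_0)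
  qed
  show "sigma0_inv (a * b) = sigma0_inv a * sigma0_inv b"
    using ab by (simp add: sigma0_inv_def un prod.union_disjoint disj ma mb)
qed (simp add: sigma0_inv_def)

lemma multiplicative_sigma0: "multiplicative sigma0"
proof -
  have "multiplicative (\<lambda>_. 1)" by (simp add: multiplicative_def)
  from multiplicative_dirichlet_conv[OF this this] show ?thesis
    by (simp add: dirichlet_conv_def[abs_def] sigma0_def[abs_def])
qed

lemma dirichlet_conv_prime_power:
  assumes "prime p"
  shows "dirichlet_conv f g (p ^ e) = (\<Sum>i\<le>e. f (p ^ i) * g (p ^ (e - i)))"
  unfolding dirichlet_conv_def sum_divisors_prime_power[OF assms]
  using prime_gt_0_nat[OF assms] by (intro sum.cong refl) (simp add: power_diff)

lemma sigma0_prime_power: "prime p \<Longrightarrow> sigma0 (p ^ e) = real e + 1"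
  using sum_divisors_prime_power[of p "\<lambda>_. 1" e] by (simp add: sigma0_def)

text \<open>The new part at a prime power is the second difference in the exponent; the case
  distinctions amount to the value 0 at negative exponents.\<close>

lemma dirichlet_conv_sigma0_inv_prime_power:
  assumes "prime p"
  shows "dirichlet_conv f sigma0_inv (p ^ e) =
    f (p ^ e) - (if e \<ge> 1 then 2 * f (p ^ (e - 1)) else 0) + (if e \<ge> 2 then f (p ^ (e - 2)) else 0)"
proof -
  have "dirichlet_conv f sigma0_inv (p ^ e) = (\<Sum>i\<le>e. f (p ^ (e - i)) * sigma0_inv (p ^ i))"
    unfolding dirichlet_conv_prime_power[OF assms]
    by (rule sum.reindex_bij_witness[of _ "\<lambda>i. e - i" "\<lambda>i. e - i"]) auto
  also have "\<dots> = (\<Sum>i\<in>{..e} \<inter> {0, 1, 2}. f (p ^ (e - i)) * sigma0_inv (p ^ i))"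
    by (intro sum.mono_neutral_right) (auto simp: sigma0_inv_prime_power[OF assms])
  also have "{..e} \<inter> {0, 1, 2} = (if e = 0 then {0} else if e = 1 then {0, 1} else {0, 1, 2::nat})"
    by auto
  finally show ?thesis by (auto simp: sigma0_inv_prime_power[OF assms] simp flip: One_nat_def)
qed

lemma dirichlet_conv_sigma0_sigma0_inv:
  assumes "n > 0"
  shows "dirichlet_conv sigma0 sigma0_inv n = (if n = 1 then 1 else 0)"
proof -
  let ?f = "dirichlet_conv sigma0 sigma0_inv"
  have mult: "multiplicative ?f"
    by (intro multiplicative_dirichlet_conv multiplicative_sigma0 multiplicative_sigma0_inv)
  have pp: "?f (p ^ e) = 0" if "prime p" "e > 0" for p e
    using that(2)
    by (auto simp: dirichlet_conv_sigma0_inv_prime_power[OF that(1)] sigma0_prime_power[OF that(1)] of_nat_diff)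
  show ?thesis
  proof (cases "n = 1")
    case False
    then obtain p where p: "prime p" "p dvd n" using prime_factor_nat by blast
    hence "p \<in> prime_factors n" "multiplicity p n > 0"
      using assms by (auto simp: in_prime_factors_iff prime_multiplicity_gt_zero_iff)
    hence "(\<Prod>p\<in>prime_factors n. ?f (p ^ multiplicity p n)) = 0"
      using pp[OF p(1)] by (intro prod_zero) auto
    thus ?thesis using multiplicative_prime_factors[OF mult assms] False by simp
  qed (use multiplicativeD(1)[OF mult] in simp)
qed

text \<open>The divisor 1 contributes \<open>f 1 * g n\<close> and all other divisors involve
  \<open>g\<close> at smaller arguments. This supplies the uniqueness behind
  \<open>dirichlet_conv_inverse\<close>.\<close>

lemma dirichlet_conv_left_cancel:
  assumes eq: "\<And>n. n > 0 \<Longrightarrow> dirichlet_conv f g n = dirichlet_conv f h n" and "f 1 \<noteq> 0" "n > 0"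
  shows "g n = h n"
  using \<open>n > 0\<close>
proof (induction n rule: less_induct)
  case (less n)
  let ?S = "{d. d dvd n}"
  have "finite ?S" "1 \<in> ?S" using less.prems by auto
  hence split: "dirichlet_conv f k n = f 1 * k n + (\<Sum>d\<in>?S - {1}. f d * k (n div d))" for k
    unfolding dirichlet_conv_def by (subst sum.remove[of ?S 1]) auto
  have "(\<Sum>d\<in>?S - {1}. f d * g (n div d)) = (\<Sum>d\<in>?S - {1}. f d * h (n div d))"
  proof (intro sum.cong refl)
    fix d assume d: "d \<in> ?S - {1}"
    hence "d > 1" using less.prems by (auto intro!: Nat.gr0I simp: nat_neq_iff)
    hence "n div d < n" "n div d > 0" using less.prems d by (auto simp: dvd_imp_le div_greater_zero_iff)
    thus "f d * g (n div d) = f d * h (n div d)" using less.IH by simp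
  qed
  thus ?case using eq[OF less.prems] split[of g] split[of h] \<open>f 1 \<noteq> 0\<close> by simp
qed

lemma dirichlet_conv_inverse_sigma0: "dirichlet_conv_inverse sigma0 = sigma0_inv"
  unfolding dirichlet_conv_inverse_def
proof (rule the_equality)
  show "sigma0_inv 0 = 0 \<and> (\<forall>n>0. dirichlet_conv sigma0 sigma0_inv n = (if n = 1 then 1 else 0))"
    using dirichlet_conv_sigma0_sigma0_inv by (simp add: sigma0_inv_def)
next
  fix g assume g: "g 0 = 0 \<and> (\<forall>n>0. dirichlet_conv sigma0 g n = (if n = 1 then 1 else 0))"
  have "g n = sigma0_inv n" for n
  proof (cases "n = 0")
    case False
    show ?thesis
    proof (rule dirichlet_conv_left_cancel)
      show "sigma0 1 \<noteq> 0" using multiplicativeD(1)[OF multiplicative_sigma0] by simp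
    qed (use g False dirichlet_conv_sigma0_sigma0_inv in auto)
  qed (use g in \<open>simp add: sigma0_inv_def\<close>)
  thus "g = sigma0_inv" by blast
qed

section \<open>Local factors\<close>

text \<open>For \<open>m = p ^ i\<close> dividing \<open>p ^ e\<close>, the gcd of \<open>m\<close>
  and its codivisor is \<open>p\<close> to the power \<open>min i (e - i)\<close>, so sums over such
  gcds take this palindromic form.\<close>

definition fold_sum :: "(nat \<Rightarrow> real) \<Rightarrow> nat \<Rightarrow> real" where
  "fold_sum f e = (\<Sum>i\<le>e. f (min i (e - i)))"

lemma fold_sum_Suc_Suc: "fold_sum f (Suc (Suc e)) = 2 * f 0 + fold_sum (\<lambda>b. f (Suc b)) e"
proof -
  have "fold_sum f (Suc (Suc e)) = f 0 + (\<Sum>i\<le>Suc e. f (min (Suc i) (Suc e - i)))"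
    by (simp add: fold_sum_def sum.atMost_Suc_shift del: sum.atMost_Suc)
  also have "(\<Sum>i\<le>Suc e. f (min (Suc i) (Suc e - i))) =
      (\<Sum>i\<le>e. f (min (Suc i) (Suc e - i))) + f 0" by simp
  also have "(\<Sum>i\<le>e. f (min (Suc i) (Suc e - i))) = fold_sum (\<lambda>b. f (Suc b)) e"
    unfolding fold_sum_def by (intro sum.cong refl) (simp add: Suc_diff_le)
  finally show ?thesis by simp
qed

text \<open>Every value of the minimum is attained twice, except the middle one for an even
  exponent. The induction strips both ends and shifts \<open>f\<close>.\<close>

lemma fold_sum_even_odd:
  "fold_sum f (2 * j) = 2 * (\<Sum>b<j. f b) + f j \<and>
   fold_sum f (2 * j + 1) = 2 * (\<Sum>b<j. f b) + 2 * f j"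
proof (induction j arbitrary: f)
  case 0
  show ?case by (simp add: fold_sum_def)
next
  case (Suc j)
  show ?case
    using Suc[of "\<lambda>b. f (Suc b)"] fold_sum_Suc_Suc[of f "2 * j"] fold_sum_Suc_Suc[of f "2 * j + 1"]
    by (simp add: sum.lessThan_Suc_shift del: sum.lessThan_Suc)
qed

lemmas fold_sum_even = fold_sum_even_odd [THEN conjunct1]
  and fold_sum_odd = fold_sum_even_odd [THEN conjunct2]

lemma sum_divisors_gcd_prime_power:
  fixes p :: nat
  assumes "prime p"
  shows "(\<Sum>m | m dvd p ^ e. f (gcd m (p ^ e div m))) = fold_sum (\<lambda>b. f (p ^ b)) e"
proof -
  have "gcd (p ^ i) (p ^ e div p ^ i) = p ^ min i (e - i)" if "i \<le> e" for i
  proof -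
    have "p ^ e div p ^ i = p ^ (e - i)"
      using that prime_gt_0_nat[OF assms] by (simp add: power_diff)
    thus ?thesis
      by (cases "i \<le> e - i") (simp_all add: min_def gcd_nat.absorb1 gcd_nat.absorb2 le_imp_power_dvd)
  qed
  thus ?thesis
    unfolding sum_divisors_prime_power[OF assms] fold_sum_def by (intro sum.cong refl) simp
qed

section \<open>The deformed cusp count and its multiplicativity\<close>

abbreviation (input) D :: "nat \<Rightarrow> real" where "D q \<equiv> real (num_primitive_characters q)"

lemma sum_primitive_real: "q > 0 \<Longrightarrow> (\<Sum>d | d dvd q. D d) = real (totient q)"
  using sum_num_primitive_characters[of q] by (simp flip: of_nat_sum)

lemma multiplicative_num_primitive_characters: "multiplicative D"
proof (rule multiplicative_sum_divisors_imp)
  have "(\<Sum>d | d dvd a * b. D d) = (\<Sum>d | d dvd a. D d) * (\<Sum>d | d dvd b. D d)"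
    if "a > 0" "b > 0" "coprime a b" for a b
    using that by (simp add: sum_primitive_real totient_mult_coprime)
  moreover have "(\<Sum>d | d dvd 1. D d) = 1" using sum_primitive_real[of 1] by simp
  ultimately show "multiplicative (\<lambda>n. \<Sum>d | d dvd n. D d)"
    unfolding multiplicative_def by blast
qed

definition cusp_zeta :: "real \<Rightarrow> nat \<Rightarrow> real" where
  "cusp_zeta \<epsilon> M = (\<Sum>m | m dvd M. \<Sum>q | q dvd gcd m (M div m).
     D q * (real q * real M / real (gcd m (M div m))) powr \<epsilon>)"

lemma cusp_zeta_0: "M > 0 \<Longrightarrow> cusp_zeta 0 M = real (num_cusps M)"
proof -
  assume M: "M > 0"
  have "cusp_zeta 0 M = (\<Sum>m | m dvd M. \<Sum>q | q dvd gcd m (M div m). D q)"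
    unfolding cusp_zeta_def
  proof (intro sum.cong refl)
    fix m q assume "m \<in> {m. m dvd M}" "q \<in> {q. q dvd gcd m (M div m)}"
    hence m: "m dvd M" and q: "q dvd gcd m (M div m)" by auto
    have "m > 0" using m M by (auto intro: Nat.gr0I)
    hence g: "gcd m (M div m) > 0" by simp
    hence "q > 0" using q by (auto intro: Nat.gr0I)
    with g M have "real q * real M / real (gcd m (M div m)) > 0" by simp
    thus "D q * (real q * real M / real (gcd m (M div m))) powr 0 = D q"
      by (subst powr_zero_eq_one) auto
  qed
  also have "\<dots> = (\<Sum>m | m dvd M. real (totient (gcd m (M div m))))"
  proof (intro sum.cong refl sum_primitive_real)
    fix m assume "m \<in> {m. m dvd M}"
    hence "m > 0" using M by (auto intro: Nat.gr0I)
    thus "gcd m (M div m) > 0" by simp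
  qed
  finally show ?thesis using num_cusps_eq[OF M] by simp
qed

lemma cusp_zeta_deriv:
  assumes M: "M > 0"
  shows "((\<lambda>\<epsilon>. cusp_zeta \<epsilon> M) has_real_derivative log_A M) (at 0)"
  unfolding cusp_zeta_def log_A_def
proof (intro DERIV_sum)
  fix m q assume "m \<in> {m. m dvd M}" "q \<in> {q. q dvd gcd m (M div m)}"
  hence m: "m dvd M" and q: "q dvd gcd m (M div m)" by auto
  have "m > 0" using m M by (auto intro: Nat.gr0I)
  hence g: "gcd m (M div m) > 0" by simp
  hence "q > 0" using q by (auto intro: Nat.gr0I)
  with g M have "real q * real M / real (gcd m (M div m)) > 0" (is "?c > 0") by simp
  thus "((\<lambda>\<epsilon>. D q * ?c powr \<epsilon>) has_real_derivative D q * ln ?c) (at 0)"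
    by (auto intro!: derivative_eq_intros)
qed

text \<open>The inner sum of \<open>cusp_zeta\<close> after the factor
  \<open>M powr \<epsilon>\<close> is taken out. It depends on \<open>m\<close> and \<open>M\<close>
  only through the gcd, and as a convolution it is visibly multiplicative.\<close>

definition char_zeta :: "real \<Rightarrow> nat \<Rightarrow> real" where
  "char_zeta \<epsilon> = dirichlet_conv D (\<lambda>k. real k powr - \<epsilon>)"

lemma multiplicative_char_zeta: "multiplicative (char_zeta \<epsilon>)"
  unfolding char_zeta_def
  by (intro multiplicative_dirichlet_conv multiplicative_num_primitive_characters)
    (simp add: multiplicative_def powr_mult)

lemma cusp_zeta_eq:
  assumes M: "M > 0"
  shows "cusp_zeta \<epsilon> M = real M powr \<epsilon> * (\<Sum>m | m dvd M. char_zeta \<epsilon> (gcd m (M div m)))"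
  unfolding cusp_zeta_def char_zeta_def dirichlet_conv_def sum_distrib_left
proof (intro sum.cong refl)
  fix m q assume "m \<in> {m. m dvd M}" "q \<in> {q. q dvd gcd m (M div m)}"
  hence m: "m dvd M" and q: "q dvd gcd m (M div m)" by auto
  let ?g = "gcd m (M div m)"
  have "m > 0" using m M by (auto intro: Nat.gr0I)
  hence g: "?g > 0" by simp
  obtain k where k: "?g = q * k" using q by blast
  with g have pos: "q > 0" "k > 0" by (auto intro: Nat.gr0I)
  have "real q * real M / real ?g = real M / real k" using pos by (simp add: k)
  hence "(real q * real M / real ?g) powr \<epsilon> = real M powr \<epsilon> * real k powr - \<epsilon>"
    using pos M by (simp add: powr_divide powr_minus_divide)
  moreover have "?g div q = k" using pos by (simp add: k)
  ultimately show "D q * (real q * real M / real ?g) powr \<epsilon> =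
      real M powr \<epsilon> * (D q * real (?g div q) powr - \<epsilon>)" by simp
qed

lemma gcd_mult_coprime:
  fixes a b x y :: nat
  assumes "coprime a b" "x dvd a" "x' dvd a" "y dvd b" "y' dvd b"
  shows "gcd (x * y) (x' * y') = gcd x x' * gcd y y'"
proof -
  have c: "coprime x y" "coprime x y'" "coprime x' y" "coprime x' y'"
    using assms coprime_divisors by blast+
  show ?thesis
  proof (rule dvd_antisym)
    obtain u v where uv: "gcd (x * y) (x' * y') = u * v" "u dvd x" "v dvd y"
      using division_decomp[of "gcd (x * y) (x' * y')" x y] by auto
    have "u * v dvd x' * y'" using uv(1) by (metis gcd_dvd2)
    hence "u dvd x' * y'" "v dvd x' * y'" by (auto dest: dvd_mult_left dvd_mult_right)
    moreover have "coprime u y'" "coprime v x'"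
      using uv c by (meson coprime_commute coprime_divisors dvd_refl)+
    ultimately have "u dvd x'" "v dvd y'"
      by (simp_all add: coprime_dvd_mult_left_iff coprime_dvd_mult_right_iff)
    thus "gcd (x * y) (x' * y') dvd gcd x x' * gcd y y'"
      unfolding uv(1) using uv by (intro mult_dvd_mono) auto
    show "gcd x x' * gcd y y' dvd gcd (x * y) (x' * y')"
      by (intro gcd_greatest mult_dvd_mono) auto
  qed
qed

text \<open>For coprime \<open>a\<close> and \<open>b\<close>, the gcd attached to a divisor
  \<open>x * y\<close> splits into the coprime gcds attached to \<open>x\<close> and
  \<open>y\<close>.\<close>

lemma multiplicative_cusp_zeta: "multiplicative (cusp_zeta \<epsilon>)"
  unfolding multiplicative_def
proof (intro conjI allI impI)
  note H = multiplicative_char_zeta[of \<epsilon>]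
  show "cusp_zeta \<epsilon> 1 = 1" using multiplicativeD(1)[OF H] by (simp add: cusp_zeta_eq)
  fix a b :: nat assume ab: "a > 0" "b > 0" "coprime a b"
  let ?H = "char_zeta \<epsilon>"
  have "(\<Sum>m | m dvd a * b. ?H (gcd m (a * b div m))) =
      (\<Sum>x | x dvd a. \<Sum>y | y dvd b. ?H (gcd (x * y) (a * b div (x * y))))"
    by (rule sum_divisors_coprime) (use ab in auto)
  also have "\<dots> = (\<Sum>x | x dvd a. \<Sum>y | y dvd b. ?H (gcd x (a div x)) * ?H (gcd y (b div y)))"
  proof (intro sum.cong refl)
    fix x y assume "x \<in> {x. x dvd a}" "y \<in> {y. y dvd b}"
    hence xy: "x dvd a" "y dvd b" by auto
    note * = divisors_coprime_facts[OF ab(3,1,2) xy]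
    have dv: "a div x dvd a" "b div y dvd b" using xy by (metis dvd_div_mult_self dvd_triv_left)+
    have "gcd (x * y) (a * b div (x * y)) = gcd x (a div x) * gcd y (b div y)"
      unfolding *(7) by (rule gcd_mult_coprime[OF ab(3) xy(1) dv(1) xy(2) dv(2)])
    moreover have "coprime (gcd x (a div x)) (gcd y (b div y))"
      using *(5) by (meson coprime_divisors gcd_dvd1)
    ultimately show "?H (gcd (x * y) (a * b div (x * y))) = ?H (gcd x (a div x)) * ?H (gcd y (b div y))"
      using multiplicativeD(2)[OF H, of "gcd x (a div x)" "gcd y (b div y)"] * by simp
  qed
  also have "\<dots> = (\<Sum>x | x dvd a. ?H (gcd x (a div x))) * (\<Sum>y | y dvd b. ?H (gcd y (b div y)))"
    by (simp add: sum_product)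
  finally show "cusp_zeta \<epsilon> (a * b) = cusp_zeta \<epsilon> a * cusp_zeta \<epsilon> b"
    using ab by (simp add: cusp_zeta_eq powr_mult mult_ac)
qed

section \<open>The new part and its derivative\<close>

definition cusp_zeta_new :: "real \<Rightarrow> nat \<Rightarrow> real" where
  "cusp_zeta_new \<epsilon> = dirichlet_conv (cusp_zeta \<epsilon>) sigma0_inv"

definition log_A_new :: "nat \<Rightarrow> real" where
  "log_A_new = dirichlet_conv log_A sigma0_inv"

lemma multiplicative_cusp_zeta_new: "multiplicative (cusp_zeta_new \<epsilon>)"
  unfolding cusp_zeta_new_def
  by (intro multiplicative_dirichlet_conv multiplicative_cusp_zeta multiplicative_sigma0_inv)

lemma cusp_zeta_new_deriv:
  assumes M: "M > 0"
  shows "((\<lambda>\<epsilon>. cusp_zeta_new \<epsilon> M) has_real_derivative log_A_new M) (at 0)"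
  unfolding cusp_zeta_new_def log_A_new_def dirichlet_conv_def
proof (intro DERIV_sum)
  fix d assume "d \<in> {d. d dvd M}"
  hence "d > 0" using M by (auto intro: Nat.gr0I)
  from DERIV_cmult_right[OF cusp_zeta_deriv[OF this]]
  show "((\<lambda>\<epsilon>. cusp_zeta \<epsilon> d * sigma0_inv (M div d)) has_real_derivative
      log_A d * sigma0_inv (M div d)) (at 0)" .
qed

text \<open>\<open>c2\<close> is a nonzero multiple of the cusp count and \<open>c3\<close> a
  combination of the cusp count and \<open>log_A\<close> with nonzero coefficient at the latter;
  convolution is linear.\<close>

lemma new_cocompact_type_iff:
  assumes M: "M > 0"
  shows "new_cocompact_type M \<longleftrightarrow> cusp_zeta_new 0 M = 0 \<and> log_A_new M = 0"
proof -
  have K: "cusp_zeta_new 0 M = (\<Sum>d | d dvd M. real (num_cusps d) * sigma0_inv (M div d))"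
    unfolding cusp_zeta_new_def dirichlet_conv_def
    by (intro sum.cong refl) (use M in \<open>auto simp: cusp_zeta_0 intro: Nat.gr0I\<close>)
  have "c2_new M = (\<Sum>d | d dvd M. - (2 / pi) * (real (num_cusps d) * sigma0_inv (M div d)))"
    by (simp add: c2_new_def dirichlet_conv_inverse_sigma0 dirichlet_conv_def c2_def mult.assoc)
  hence c2: "c2_new M = - (2 / pi) * cusp_zeta_new 0 M"
    by (simp only: K sum_distrib_left)
  have "c3_new M = (\<Sum>d | d dvd M.
      (2 - ln 2 + ln pi) / pi * (real (num_cusps d) * sigma0_inv (M div d)) -
      1 / pi * (log_A d * sigma0_inv (M div d)))"
    unfolding c3_new_def dirichlet_conv_inverse_sigma0 dirichlet_conv_def c3_def
    by (intro sum.cong refl) (simp add: field_simps)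
  hence "c3_new M = (2 - ln 2 + ln pi) / pi * cusp_zeta_new 0 M - 1 / pi * log_A_new M"
    by (simp only: K sum_distrib_left sum_subtractf log_A_new_def dirichlet_conv_def)
  with c2 show ?thesis by (auto simp: new_cocompact_type_def)
qed

section \<open>Values and derivatives at prime powers\<close>

lemma cusp_zeta_0_prime_power:
  assumes "prime p"
  shows "cusp_zeta 0 (p ^ e) = fold_sum (\<lambda>b. real (totient (p ^ b))) e"
  using prime_gt_0_nat[OF assms] sum_divisors_gcd_prime_power[OF assms, of "\<lambda>g. real (totient g)" e]
  by (simp add: cusp_zeta_0 num_cusps_eq)

text \<open>The derivative of \<open>char_zeta \<epsilon> g\<close> at \<epsilon> = 0, that is, the
  part of \<open>log_A\<close> left after splitting off the logarithm of \<open>M\<close>.\<close>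

definition conductor_defect :: "nat \<Rightarrow> real" where
  "conductor_defect g = (\<Sum>q | q dvd g. D q * ln (real q / real g))"

lemma log_A_eq:
  assumes M: "M > 0"
  shows "log_A M = (\<Sum>m | m dvd M. conductor_defect (gcd m (M div m))) + ln (real M) * cusp_zeta 0 M"
proof -
  have "log_A M = (\<Sum>m | m dvd M. conductor_defect (gcd m (M div m)) +
      ln (real M) * real (totient (gcd m (M div m))))"
    unfolding log_A_def
  proof (intro sum.cong refl)
    fix m assume "m \<in> {m. m dvd M}"
    hence "m > 0" using M by (auto intro: Nat.gr0I)
    let ?g = "gcd m (M div m)"
    have g: "?g > 0" using \<open>m > 0\<close> by simp
    have "(\<Sum>q | q dvd ?g. D q * ln (real q * real M / real ?g)) =
        (\<Sum>q | q dvd ?g. D q * ln (real q / real ?g) + ln (real M) * D q)"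
    proof (intro sum.cong refl)
      fix q assume "q \<in> {q. q dvd ?g}"
      hence "q > 0" using g by (auto intro: Nat.gr0I)
      hence "ln (real q * real M / real ?g) = ln (real q / real ?g) + ln (real M)"
        using g M by (simp add: ln_mult ln_div)
      thus "D q * ln (real q * real M / real ?g) = D q * ln (real q / real ?g) + ln (real M) * D q"
        by (simp add: algebra_simps)
    qed
    also have "\<dots> = conductor_defect ?g + ln (real M) * real (totient ?g)"
      using sum_primitive_real[OF g]
      by (simp add: sum.distrib conductor_defect_def flip: sum_distrib_left)
    finally show "(\<Sum>q | q dvd ?g. D q * ln (real q * real M / real ?g)) =
        conductor_defect ?g + ln (real M) * real (totient ?g)" .
  qed
  thus ?thesis using M
    by (simp add: sum.distrib cusp_zeta_0 num_cusps_eq sum_distrib_left)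
qed

lemma log_A_prime_power:
  assumes "prime p"
  shows "log_A (p ^ e) = fold_sum (\<lambda>b. conductor_defect (p ^ b)) e +
    real e * ln (real p) * fold_sum (\<lambda>b. real (totient (p ^ b))) e"
  using prime_gt_0_nat[OF assms] sum_divisors_gcd_prime_power[OF assms, of conductor_defect e]
  by (simp add: log_A_eq cusp_zeta_0_prime_power[OF assms] ln_realpow)

text \<open>With S the sum of \<open>f b\<close> over \<open>b < j\<close>,
  \<open>fold_sum f\<close> takes the values 2 S, 2 S + \<open>f j\<close> and 2 S + 2
  \<open>f j\<close> at \<open>2 * j - 1\<close>, \<open>2 * j\<close> and \<open>2 * j + 1\<close>:
  an arithmetic progression, for any \<open>f\<close>.\<close>

lemma cusp_zeta_new_0_odd_power:
  assumes "prime p"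
  shows "cusp_zeta_new 0 (p ^ (2 * j + 1)) = 0"
\<comment> \<open>At exponent 1 the second difference has only two terms, so \<open>j = 0\<close> is
  separate.\<close>
proof (cases j)
  case 0
  show ?thesis using fold_sum_odd[of "\<lambda>b. real (totient (p ^ b))" 0] fold_sum_even[of "\<lambda>b. real (totient (p ^ b))" 0]
    by (simp add: 0 cusp_zeta_new_def dirichlet_conv_sigma0_inv_prime_power[OF assms, of _ 1, simplified]
       cusp_zeta_0_prime_power[OF assms, of 1, simplified] cusp_zeta_0_prime_power[OF assms, of 0, simplified])
next
  case (Suc i)
  let ?t = "\<lambda>b. real (totient (p ^ b))"
  have "cusp_zeta_new 0 (p ^ (2 * j + 1)) =
      fold_sum ?t (2 * j + 1) - 2 * fold_sum ?t (2 * j) + fold_sum ?t (2 * i + 1)"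
    by (simp add: Suc cusp_zeta_new_def dirichlet_conv_sigma0_inv_prime_power[OF assms]
        cusp_zeta_0_prime_power[OF assms] del: power_Suc)
  thus ?thesis by (simp only: fold_sum_even fold_sum_odd) (simp add: Suc)
qed

lemma cusp_zeta_new_0_even_power:
  assumes "prime p"
  shows "cusp_zeta_new 0 (p ^ (2 * Suc i)) = real (totient (p ^ Suc i)) - real (totient (p ^ i))"
proof -
  let ?t = "\<lambda>b. real (totient (p ^ b))"
  have "cusp_zeta_new 0 (p ^ (2 * Suc i)) =
      fold_sum ?t (2 * Suc i) - 2 * fold_sum ?t (2 * i + 1) + fold_sum ?t (2 * i)"
    by (simp add: cusp_zeta_new_def dirichlet_conv_sigma0_inv_prime_power[OF assms]
        cusp_zeta_0_prime_power[OF assms] del: power_Suc)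
  thus ?thesis by (simp only: fold_sum_even fold_sum_odd) simp
qed

text \<open>The conductor terms cancel just as the cusp count does. What remains comes from the
  extra factor \<open>e\<close>: the outer two values of the progression differ by 2
  \<open>totient (p ^ j)\<close>.\<close>

lemma log_A_new_odd_power:
  assumes "prime p"
  shows "log_A_new (p ^ (2 * j + 1)) = 2 * ln (real p) * real (totient (p ^ j))"
proof (cases j)
  case 0
  show ?thesis
    using fold_sum_odd[of "\<lambda>b. real (totient (p ^ b))" 0] fold_sum_even[of "\<lambda>b. real (totient (p ^ b))" 0]
      fold_sum_even[of "\<lambda>b. real (totient (p ^ b))" 0]
      fold_sum_odd[of "\<lambda>b. conductor_defect (p ^ b)" 0]
      fold_sum_even[of "\<lambda>b. conductor_defect (p ^ b)" 0]
    by (simp add: 0 log_A_new_def dirichlet_conv_sigma0_inv_prime_power[OF assms, of _ 1, simplified]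
       log_A_prime_power[OF assms, of 1, simplified] log_A_prime_power[OF assms, of 0, simplified]
       conductor_defect_def)
next
  case (Suc i)
  let ?t = "\<lambda>b. real (totient (p ^ b))" and ?u = "\<lambda>b. conductor_defect (p ^ b)"
  have "log_A_new (p ^ (2 * j + 1)) =
      (fold_sum ?u (2 * j + 1) + real (2 * j + 1) * ln p * fold_sum ?t (2 * j + 1)) -
      2 * (fold_sum ?u (2 * j) + real (2 * j) * ln p * fold_sum ?t (2 * j)) +
      (fold_sum ?u (2 * i + 1) + real (2 * i + 1) * ln p * fold_sum ?t (2 * i + 1))"
    by (simp add: Suc log_A_new_def dirichlet_conv_sigma0_inv_prime_power[OF assms]
        log_A_prime_power[OF assms] del: power_Suc)
  thus ?thesis by (simp only: fold_sum_even fold_sum_odd) (simp add: Suc algebra_simps)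
qed

text \<open>There is no primitive character mod 2, because \<open>totient 2\<close> is already
  exhausted by \<open>D 1\<close>; hence only \<open>q = 1\<close> contributes to
  \<open>conductor_defect 2\<close>.\<close>

lemma log_A_new_4: "log_A_new 4 = ln 2"
proof -
  have D1: "D 1 = 1" using multiplicativeD(1)[OF multiplicative_num_primitive_characters] .
  have div2: "{d. d dvd 2} = {1, 2::nat}"
    using divides_primepow_nat[of 2 _ 1] by (auto simp: le_Suc_eq)
  have D2: "D 2 = 0" using sum_primitive_real[of 2] D1 by (simp add: div2)
  have u: "conductor_defect 1 = 0" "conductor_defect 2 = - ln 2"
    using D1 D2 by (simp_all add: conductor_defect_def div2 ln_div)
  have F: "fold_sum f 0 = f 0" "fold_sum f 1 = 2 * f 0" "fold_sum f 2 = 2 * f 0 + f 1" for f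
    using fold_sum_even[of f 0] fold_sum_odd[of f 0] fold_sum_even[of f 1] by simp_all
  have "log_A_new (2 ^ 2) = log_A (2 ^ 2) - 2 * log_A (2 ^ 1) + log_A (2 ^ 0)"
    unfolding log_A_new_def by (subst dirichlet_conv_sigma0_inv_prime_power) auto
  \<comment> \<open>The three values of \<open>log_A\<close> at 4, 2 and 1 are 5
    \<open>ln 2\<close>, 2 \<open>ln 2\<close> and 0.\<close>
  also have "\<dots> = ln 2"
    unfolding log_A_prime_power[OF two_is_prime_nat] F using u by simp
  finally show ?thesis by simp
qed

text \<open>At an even exponent the factor is a difference of consecutive totients. From
  \<open>p\<close> on, consecutive totients differ by the factor \<open>p\<close>, so equality can
  only be \<open>p - 1 = 1\<close>.\<close>

lemma cusp_zeta_new_0_eq_0_iff: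
  assumes "prime p" "e > 0"
  shows "cusp_zeta_new 0 (p ^ e) = 0 \<longleftrightarrow> odd e \<or> p = 2 \<and> e = 2"
proof (cases "even e")
  case False
  thus ?thesis using cusp_zeta_new_0_odd_power[OF assms(1)] by (auto elim!: oddE)
next
  case True
  then obtain i where e: "e = 2 * Suc i" using assms(2) by (metis dvdE gr0_conv_Suc mult_is_0 neq0_conv)
  have p: "p \<ge> 2" using assms(1) by (simp add: prime_ge_2_nat)
  have "totient (p ^ Suc i) = totient (p ^ i) \<longleftrightarrow> p = 2 \<and> i = 0"
  proof (cases i)
    case 0
    thus ?thesis using totient_prime[OF assms(1)] p by auto
  next
    case (Suc k)
    have "totient (p ^ Suc i) = p * totient (p ^ i)"
      using p by (simp add: Suc totient_power_Suc del: power_Suc)  simp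
    moreover have "totient (p ^ i) > 0" using p by simp
    ultimately show ?thesis using Suc p by simp
  qed
  thus ?thesis using True unfolding e cusp_zeta_new_0_even_power[OF assms(1)] by simp
qed

lemma log_A_new_nz:
  assumes "prime p" "e > 0" "cusp_zeta_new 0 (p ^ e) = 0"
  shows "log_A_new (p ^ e) \<noteq> 0"
proof -
  have "odd e \<or> p = 2 \<and> e = 2" using assms cusp_zeta_new_0_eq_0_iff by blast
  thus ?thesis
  proof
    assume "odd e"
    then obtain j where e: "e = 2 * j + 1" by (elim oddE)
    have "ln (real p) > 0" using prime_gt_1_nat[OF assms(1)] by simp
    moreover have "totient (p ^ j) > 0" using prime_gt_0_nat[OF assms(1)] by simp
    ultimately show ?thesis unfolding e log_A_new_odd_power[OF assms(1)] by simp
  next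
    assume "p = 2 \<and> e = 2"
    thus ?thesis using log_A_new_4 by simp
  qed
qed

text \<open>By the product rule \<open>log_A_new M\<close> is a sum over primes in which one factor
  is differentiated. With two vanishing factors every summand still contains one of them; with
  exactly one, only its own summand survives, and that is nonzero by
  \<open>log_A_new_nz\<close>.\<close>

lemma new_cocompact_type_iff_card:
  assumes M: "M > 0"
  defines "Z \<equiv> {p \<in> prime_factors M. odd (multiplicity p M) \<or> p = 2 \<and> multiplicity p M = 2}"
  shows "new_cocompact_type M \<longleftrightarrow> card Z \<ge> 2"
proof -
  let ?P = "prime_factors M" and ?e = "\<lambda>p. multiplicity p M"
  let ?K = "\<lambda>p. cusp_zeta_new 0 (p ^ ?e p)"
  have P: "prime p" "?e p > 0" if "p \<in> ?P" for p
    using that M by (auto simp: in_prime_factors_iff prime_multiplicity_gt_zero_iff)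
  have Z: "p \<in> Z \<longleftrightarrow> ?K p = 0" if "p \<in> ?P" for p
    using that cusp_zeta_new_0_eq_0_iff[OF P[OF that]] by (simp add: Z_def)
  have ZP: "Z \<subseteq> ?P" by (auto simp: Z_def)
  hence fin: "finite Z" using finite_subset by blast
  have K: "cusp_zeta_new 0 M = (\<Prod>p\<in>?P. ?K p)"
    by (rule multiplicative_prime_factors[OF multiplicative_cusp_zeta_new M])
  have d: "((\<lambda>\<epsilon>. \<Prod>p\<in>?P. cusp_zeta_new \<epsilon> (p ^ ?e p)) has_real_derivative
      (\<Sum>p\<in>?P. log_A_new (p ^ ?e p) * (\<Prod>r\<in>?P - {p}. ?K r))) (at 0)"
    by (intro has_field_derivative_prod cusp_zeta_new_deriv) (use P in \<open>auto simp: prime_gt_0_nat\<close>)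
  \<comment> \<open>Both sides are derivatives at 0 of the same function, written once as a whole
    and once as a product.\<close>
  have L: "log_A_new M = (\<Sum>p\<in>?P. log_A_new (p ^ ?e p) * (\<Prod>r\<in>?P - {p}. ?K r))"
    using cusp_zeta_new_deriv[OF M] d
    unfolding multiplicative_prime_factors[OF multiplicative_cusp_zeta_new M, symmetric]
    by (rule DERIV_unique)
  show ?thesis
  proof
    assume "card Z \<ge> 2"
    hence "\<not> card Z \<le> Suc 0" by simp
    then obtain p r where pr: "p \<in> Z" "r \<in> Z" "p \<noteq> r"
      unfolding card_le_Suc0_iff_eq[OF fin] by blast
    have z: "(\<Prod>r\<in>?P - {x}. ?K r) = 0" for x
    proof -
      obtain y where y: "y \<in> Z" "y \<noteq> x" using pr by blast
      moreover have "y \<in> ?P" using y ZP by blast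
      moreover from this have "?K y = 0" using y Z by blast
      ultimately show ?thesis by (intro prod_zero bexI[of _ y]) simp_all
    qed
    have "log_A_new M = 0" unfolding L by (simp only: z mult_zero_right sum.neutral_const)
    moreover have "p \<in> ?P" using pr ZP by blast
    moreover from this have "?K p = 0" using pr Z by blast
    ultimately have "cusp_zeta_new 0 M = 0"
      unfolding K by (intro prod_zero bexI[of _ p]) simp_all
    with \<open>log_A_new M = 0\<close>
    show "new_cocompact_type M" using new_cocompact_type_iff[OF M] by blast
  next
    assume "new_cocompact_type M"
    hence K0: "cusp_zeta_new 0 M = 0" and L0: "log_A_new M = 0"
      using new_cocompact_type_iff[OF M] by auto
    from K0 obtain p where p: "p \<in> ?P" "?K p = 0" unfolding K by auto
    hence pZ: "p \<in> Z" using Z by blast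
    show "card Z \<ge> 2"
    proof (rule ccontr)
      assume "\<not> card Z \<ge> 2"
      hence "card Z \<le> Suc 0" by simp
      hence uniq: "r = p" if "r \<in> Z" for r
        using that pZ card_le_Suc0_iff_eq[OF fin] by blast
      have "log_A_new M = log_A_new (p ^ ?e p) * (\<Prod>r\<in>?P - {p}. ?K r) +
          (\<Sum>x\<in>?P - {p}. log_A_new (x ^ ?e x) * (\<Prod>r\<in>?P - {x}. ?K r))"
        unfolding L by (rule sum.remove) (use p in auto)
      also have "(\<Sum>x\<in>?P - {p}. log_A_new (x ^ ?e x) * (\<Prod>r\<in>?P - {x}. ?K r)) = 0"
      proof (intro sum.neutral ballI)
        fix x assume "x \<in> ?P - {p}"
        hence "(\<Prod>r\<in>?P - {x}. ?K r) = 0"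
          using p by (intro prod_zero bexI[of _ p]) simp_all
        thus "log_A_new (x ^ ?e x) * (\<Prod>r\<in>?P - {x}. ?K r) = 0" by simp
      qed
      finally have "log_A_new (p ^ ?e p) * (\<Prod>r\<in>?P - {p}. ?K r) = 0" using L0 by simp
      moreover have "log_A_new (p ^ ?e p) \<noteq> 0" using log_A_new_nz[OF P[OF p(1)] p(2)] .
      moreover have "?K r \<noteq> 0" if "r \<in> ?P - {p}" for r using that uniq Z by blast
      hence "(\<Prod>r\<in>?P - {p}. ?K r) \<noteq> 0" by simp
      ultimately show False by simp
    qed
  qed
qed

theorem theorem5p10:
  fixes M t n :: nat
  assumes "M > 0" and "t > 0" and "n > 0"
    and "M = t ^ 2 * n" and "squarefree n"
  shows "new_cocompact_type M \<longleftrightarrow>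
           card {p. prime p \<and> p dvd n} \<ge> 2 \<or>
           (n > 1 \<and> 4 dvd M \<and> gcd 2 (M div 4) = 1)"
proof -
  let ?Z = "{p \<in> prime_factors M. odd (multiplicity p M) \<or> p = 2 \<and> multiplicity p M = 2}"
  let ?N = "{p. prime p \<and> p dvd n}"
  let ?C = "4 dvd M \<and> gcd 2 (M div 4) = 1"
  \<comment> \<open>Consequently the primes of odd multiplicity in \<open>M\<close> are exactly the
    primes dividing \<open>n\<close>.\<close>
  have mult: "multiplicity p M = 2 * multiplicity p t + (if p dvd n then 1 else 0)" if "prime p" for p
  proof -
    have "multiplicity p n = (if p dvd n then 1 else 0)"
    proof (cases "p dvd n")
      case True
      hence "p \<in> prime_factors n" using that assms(3) by (simp add: in_prime_factors_iff)
      moreover have "\<forall>p\<in>prime_factors n. multiplicity p n = 1"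
        using squarefree_factorial_semiring'[of n] assms(3,5) by simp
      ultimately show ?thesis using True by simp
    qed (simp add: not_dvd_imp_multiplicity_0)
    thus ?thesis using that assms
      by (simp add: prime_elem_multiplicity_mult_distrib prime_elem_multiplicity_power_distrib)
  qed
  have C: "?C \<longleftrightarrow> multiplicity 2 M = 2"
  proof
    assume c: ?C
    then obtain k where k: "M = 4 * k" by blast
    with c have "gcd 2 k = 1" by simp
    hence "odd k" using gcd_eq_1_imp_coprime coprime_left_2_iff_odd by blast
    hence "multiplicity 2 (2 ^ 2 * k) = 2"
      using assms(1) k by (intro multiplicity_decomposeI[of _ _ _ k]) auto
    thus "multiplicity 2 M = 2" by (simp add: k)
  next
    assume m: "multiplicity 2 M = 2"
    have "2 ^ 2 dvd M" using multiplicity_dvd[of 2 M] m by simp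
    then obtain k where k: "M = 4 * k" by auto
    have "odd k"
    proof
      assume "even k"
      hence "2 ^ 3 dvd M" using k by auto
      hence "multiplicity 2 M \<ge> 3" using assms(1) by (intro multiplicity_geI) auto
      with m show False by simp
    qed
    hence "gcd 2 k = 1" using coprime_left_2_iff_odd coprime_imp_gcd_eq_1 by blast
    thus ?C using k by simp
  qed
  have fin: "finite ?N" using assms(3) by (rule_tac finite_subset[of _ "{..n}"]) (auto dest: dvd_imp_le)
  have Neq: "?N \<subseteq> prime_factors M"
    using assms by (auto simp: in_prime_factors_iff)
  have iff: "new_cocompact_type M \<longleftrightarrow> card ?Z \<ge> 2"
    by (rule new_cocompact_type_iff_card[OF assms(1)])
  show ?thesis
  proof (cases ?C)
    case True
    hence m2: "multiplicity 2 M = 2" by (rule iffD1[OF C])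
    have "\<not> 2 dvd n"
    proof
      assume "2 dvd n"
      hence "2 = 2 * multiplicity 2 t + 1" using mult[of 2] m2 by simp
      thus False by presburger
    qed
    hence "2 \<notin> ?N" by simp
    moreover have "2 \<in> prime_factors M" using True assms(1) by (auto simp: in_prime_factors_iff)
    \<comment> \<open>Here 2 is a vanishing prime in addition to those of \<open>n\<close>, so a
      single prime divisor of \<open>n\<close> completes the pair; without \<open>?C\<close> only
      the primes of \<open>n\<close> are left.\<close>
    hence "?Z = insert 2 ?N"
      using Neq m2 mult by (auto simp: in_prime_factors_iff)
    ultimately have "card ?Z = Suc (card ?N)" using fin by simp
    moreover have "card ?N \<ge> 1 \<longleftrightarrow> n > 1"
    proof
      assume "card ?N \<ge> 1"
      hence "?N \<noteq> {}" by (metis card.empty not_one_le_zero)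
      then obtain p where "prime p" "p dvd n" by blast
      hence "n \<noteq> 1" by auto
      thus "n > 1" using assms(3) by simp
    next
      assume "n > 1"
      then obtain p where "prime p" "p dvd n" using prime_factor_nat[of n] by auto
      hence "?N \<noteq> {}" by blast
      thus "card ?N \<ge> 1" using fin by (simp add: Suc_leI card_gt_0_iff)
    qed
    ultimately show ?thesis using iff True by auto
  next
    case False
    hence "multiplicity 2 M \<noteq> 2" using iffD2[OF C] by (rule contrapos_nn)
    hence "?Z = ?N" using Neq mult by (auto simp: in_prime_factors_iff)
    thus ?thesis using iff False by auto
  qed
qed

end
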